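(* Let $n\ge 2$ and let $\Gamma$ be a finite regular cover of the rose $\mathbf{R}_n$. Then the diameter of every connected component of the separability complex $\mathrm{SC}(\Gamma)$ is infinite.
   Context: $\mathbf{F}_n$ is the free group on $X_n=\{x_1,\dots,x_n\}$, and $\mathbf{R}_n$ is the rose (graph with one vertex and $n$ edges), with $\pi_1(\mathbf{R}_n)$ identified with $\mathbf{F}_n$. For a finite regular cover $\Gamma\to\mathbf{R}_n$, $\pi_1(\Gamma)$ is identified with the corresponding finite-index normal subgroup of $\mathbf{F}_n$. A proper free factor of $\mathbf{F}_n$ is a nontrivial proper subgroup $F$ such that $\mathbf{F}_n=F*G$ for some nontrivial proper subgroup $G$. An element of $\mathbf{F}_n$ is separable if it lies in some proper free factor; $\mathcal{C}^{\mathrm{sep}}$ is the set of separable elements. The separability complex $\mathrm{SC}(\Gamma)$ is the directed graph defined as follows. Its vertices are the $\mathbf{F}_n$-conjugacy classes $[v]$ of elements $v\in\pi_1(\Gamma)$. Each edge is labeled by the $\mathbf{F}_n$-conjugacy class $[\alpha]$ of a nontrivial element of $\mathcal{C}^{\mathrm{sep}}\cap\pi_1(\Gamma)$; there is an edge labeled $[\alpha]$ from $[v]$ to $[w]$ whenever there are $\hat\alpha\in[\alpha]$, $\hat v\in[v]$, $\hat w\in[w]$ with $\hat w=\hat v\hat\alpha$ in $\mathbf{F}_n$. It carries the path metric in which every edge has length one. *)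

theory Defs
  imports "HOL-Algebra.Coset" "Graph_Theory.Graph_Theory"
begin

section \<open>Free groups\<close>

text \<open>
  A letter \<open>(x, True)\<close> stands for the generator \<open>x\<close> and \<open>(x, False)\<close> for its inverse.  Elements
  of the free group on \<open>X\<close> are the freely reduced words over \<open>X\<close>.
\<close>

type_synonym 'x word = "('x \<times> bool) list"

definition inv_letter :: "'x \<times> bool \<Rightarrow> 'x \<times> bool" where
  "inv_letter a = (fst a, \<not> snd a)"

definition reduced :: "'x word \<Rightarrow> bool" where
  "reduced w \<longleftrightarrow> successively (\<lambda>a b. b \<noteq> inv_letter a) w"

fun red_cons :: "'x \<times> bool \<Rightarrow> 'x word \<Rightarrow> 'x word" where
  "red_cons a [] = [a]"
| "red_cons a (b # w) = (if b = inv_letter a then w else a # b # w)"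

definition free_reduce :: "'x word \<Rightarrow> 'x word" where
  "free_reduce w = foldr red_cons w []"

definition free_group :: "'x set \<Rightarrow> 'x word monoid" where
  "free_group X = \<lparr> carrier = {w. reduced w \<and> fst ` set w \<subseteq> X},
                     monoid.mult = (\<lambda>u v. free_reduce (u @ v)),
                     one = [] \<rparr>"

lemma inv_letter_inv_letter [simp]: "inv_letter (inv_letter a) = a"
  by (simp add: inv_letter_def)

lemma inv_letter_neq [simp]: "inv_letter a \<noteq> a"
  by (cases a) (simp add: inv_letter_def)

lemma fst_inv_letter [simp]: "fst (inv_letter a) = fst a"
  by (simp add: inv_letter_def)

lemma reduced_Nil [simp]: "reduced []"
  by (simp add: reduced_def)

lemma reduced_ConsD: "reduced (a # w) \<Longrightarrow> reduced w"
  by (cases w) (auto simp: reduced_def)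

lemma reduced_red_cons: "reduced w \<Longrightarrow> reduced (red_cons a w)"
  by (cases w) (auto simp: reduced_def dest: reduced_ConsD[unfolded reduced_def])

lemma red_cons_reduced: "reduced (a # w) \<Longrightarrow> red_cons a w = a # w"
  by (cases w) (auto simp: reduced_def)

lemma red_cons_cancel: "reduced w \<Longrightarrow> red_cons a (red_cons (inv_letter a) w) = w"
  by (cases w) (auto simp: red_cons_reduced)

lemma reduced_foldr: "reduced w \<Longrightarrow> reduced (foldr red_cons u w)"
  by (induction u) (auto intro: reduced_red_cons)

lemma reduced_free_reduce [simp]: "reduced (free_reduce w)"
  by (simp add: free_reduce_def reduced_foldr)

lemma free_reduce_reduced: "reduced w \<Longrightarrow> free_reduce w = w"
proof (induction w)
  case (Cons a w)
  then show ?case using reduced_ConsD[OF Cons.prems] by (simp add: free_reduce_def red_cons_reduced)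
qed (simp add: free_reduce_def)

lemma free_reduce_append: "free_reduce (u @ v) = foldr red_cons u (free_reduce v)"
  by (simp add: free_reduce_def)

lemma foldr_red_cons:
  "reduced w \<Longrightarrow> foldr red_cons (red_cons a r) w = red_cons a (foldr red_cons r w)"
  by (cases r) (auto simp: red_cons_cancel reduced_foldr)

lemma foldr_free_reduce:
  "reduced w \<Longrightarrow> foldr red_cons (free_reduce u) w = foldr red_cons u w"
  by (induction u) (auto simp: free_reduce_def foldr_red_cons)

lemma free_reduce_append_left [simp]: "free_reduce (free_reduce u @ v) = free_reduce (u @ v)"
  by (simp add: free_reduce_append foldr_free_reduce)

lemma free_reduce_append_right [simp]: "free_reduce (u @ free_reduce v) = free_reduce (u @ v)"
  by (simp add: free_reduce_append free_reduce_reduced)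

lemma set_red_cons: "set (red_cons a w) \<subseteq> insert a (set w)"
  by (cases w) auto

lemma set_free_reduce: "set (free_reduce w) \<subseteq> set w"
proof (induction w)
  case (Cons a w)
  have "free_reduce (a # w) = red_cons a (free_reduce w)" by (simp add: free_reduce_def)
  then show ?case using Cons set_red_cons[of a "free_reduce w"] by auto
qed (simp add: free_reduce_def)

definition inv_word :: "'x word \<Rightarrow> 'x word" where
  "inv_word w = rev (map inv_letter w)"

lemma free_reduce_inv_word: "free_reduce (inv_word w @ w) = []"
proof -
  have "foldr red_cons (inv_word w) (foldr red_cons w v) = v" if "reduced v" for v
    using that
  proof (induction w arbitrary: v)
    case (Cons a w)
    have "red_cons (inv_letter a) (red_cons a (foldr red_cons w v)) = foldr red_cons w v"
      using red_cons_cancel[of "foldr red_cons w v" "inv_letter a"] Cons.prems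
      by (simp add: reduced_foldr)
    then show ?case using Cons by (simp add: inv_word_def)
  qed (simp add: inv_word_def)
  then show ?thesis by (simp add: free_reduce_append) (simp add: free_reduce_def)
qed

lemma group_free_group: "group (free_group X)"
proof (rule groupI)
  fix u v assume "u \<in> carrier (free_group X)" "v \<in> carrier (free_group X)"
  then show "u \<otimes>\<^bsub>free_group X\<^esub> v \<in> carrier (free_group X)"
    using set_free_reduce[of "u @ v"] by (fastforce simp: free_group_def)
next
  fix u assume u: "u \<in> carrier (free_group X)"
  let ?v = "free_reduce (inv_word u)"
  have "fst ` set ?v \<subseteq> fst ` set (inv_word u)" by (intro image_mono set_free_reduce)
  also have "\<dots> \<subseteq> X" using u by (auto simp: free_group_def inv_word_def)
  finally have "fst ` set ?v \<subseteq> X" .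
  then have "?v \<in> carrier (free_group X)" by (simp add: free_group_def)
  moreover have "?v \<otimes>\<^bsub>free_group X\<^esub> u = \<one>\<^bsub>free_group X\<^esub>"
    by (simp add: free_group_def free_reduce_inv_word)
  ultimately show "\<exists>v\<in>carrier (free_group X). v \<otimes>\<^bsub>free_group X\<^esub> u = \<one>\<^bsub>free_group X\<^esub>" by blast
qed (simp_all add: free_group_def free_reduce_reduced)


section \<open>Free factors and separable elements\<close>

text \<open>
  The free product of \<open>F\<close> and \<open>G\<close> consists of the alternating sequences of nontrivial elements of
  \<open>F\<close> (tagged \<open>True\<close>) and of \<open>G\<close> (tagged \<open>False\<close>).  The group \<open>K\<close> is the internal free product of
  its subgroups \<open>F\<close> and \<open>G\<close> when the canonical map from their free product to \<open>K\<close> is bijective.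
\<close>

definition free_product_seqs ::
    "('a, 'b) monoid_scheme \<Rightarrow> 'a set \<Rightarrow> 'a set \<Rightarrow> (bool \<times> 'a) list set" where
  "free_product_seqs K F G =
     {s. (\<forall>(t, g)\<in>set s. g \<in> (if t then F else G) - {\<one>\<^bsub>K\<^esub>}) \<and>
         successively (\<lambda>a b. fst a \<noteq> fst b) s}"

definition seq_product :: "('a, 'b) monoid_scheme \<Rightarrow> (bool \<times> 'a) list \<Rightarrow> 'a" where
  "seq_product K s = foldr (\<lambda>a h. snd a \<otimes>\<^bsub>K\<^esub> h) s \<one>\<^bsub>K\<^esub>"

definition internal_free_product ::
    "('a, 'b) monoid_scheme \<Rightarrow> 'a set \<Rightarrow> 'a set \<Rightarrow> bool" where
  "internal_free_product K F G \<longleftrightarrow>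
     subgroup F K \<and> subgroup G K \<and>
     bij_betw (seq_product K) (free_product_seqs K F G) (carrier K)"

definition nontrivial_proper_subgroup :: "'a set \<Rightarrow> ('a, 'b) monoid_scheme \<Rightarrow> bool" where
  "nontrivial_proper_subgroup F K \<longleftrightarrow> subgroup F K \<and> F \<noteq> {\<one>\<^bsub>K\<^esub>} \<and> F \<noteq> carrier K"

definition proper_free_factor :: "'a set \<Rightarrow> ('a, 'b) monoid_scheme \<Rightarrow> bool" where
  "proper_free_factor F K \<longleftrightarrow>
     nontrivial_proper_subgroup F K \<and>
     (\<exists>G. nontrivial_proper_subgroup G K \<and> internal_free_product K F G)"

definition separable_elements :: "('a, 'b) monoid_scheme \<Rightarrow> 'a set" where
  "separable_elements K = \<Union>{F. proper_free_factor F K}"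


section \<open>Finite regular covers of the rose\<close>

text \<open>
  A graph is represented by a \<^typ>\<open>('v, 'e) pre_digraph\<close> in which every edge is given exactly once,
  with one of its two orientations; edge paths may cross it either way.  The rose carries the
  orientation given by the generators, and every cover of the rose carries the orientation pulled
  back along the covering map, so covering maps and deck transformations preserve orientations.
\<close>

definition rose :: "nat \<Rightarrow> (unit, nat) pre_digraph" where
  "rose n = \<lparr> verts = {()}, arcs = {1..n}, tail = (\<lambda>_. ()), head = (\<lambda>_. ()) \<rparr>"

definition graph_hom ::
    "('v, 'e) pre_digraph \<Rightarrow> ('w, 'f) pre_digraph \<Rightarrow> ('v \<Rightarrow> 'w) \<Rightarrow> ('e \<Rightarrow> 'f) \<Rightarrow> bool" where
  "graph_hom G R pV pE \<longleftrightarrow>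
     pV ` verts G \<subseteq> verts R \<and> pE ` arcs G \<subseteq> arcs R \<and>
     (\<forall>e\<in>arcs G. tail R (pE e) = pV (tail G e) \<and> head R (pE e) = pV (head G e))"

text \<open>
  A covering map is bijective on the star of each vertex, i.e. on outgoing and on incoming arcs
  separately (a loop contributes to both).
\<close>

definition covering_map ::
    "('v, 'e) pre_digraph \<Rightarrow> ('w, 'f) pre_digraph \<Rightarrow> ('v \<Rightarrow> 'w) \<Rightarrow> ('e \<Rightarrow> 'f) \<Rightarrow> bool" where
  "covering_map G R pV pE \<longleftrightarrow>
     wf_digraph G \<and> wf_digraph R \<and> graph_hom G R pV pE \<and> pV ` verts G = verts R \<and>
     (\<forall>v\<in>verts G. bij_betw pE (out_arcs G v) (out_arcs R (pV v)) \<and>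
                   bij_betw pE (in_arcs G v) (in_arcs R (pV v)))"

definition deck_transformation ::
    "('v, 'e) pre_digraph \<Rightarrow> ('v \<Rightarrow> 'w) \<Rightarrow> ('e \<Rightarrow> 'f) \<Rightarrow> ('v \<Rightarrow> 'v) \<Rightarrow> ('e \<Rightarrow> 'e) \<Rightarrow> bool" where
  "deck_transformation G pV pE hV hE \<longleftrightarrow>
     graph_hom G G hV hE \<and> bij_betw hV (verts G) (verts G) \<and> bij_betw hE (arcs G) (arcs G) \<and>
     (\<forall>v\<in>verts G. pV (hV v) = pV v) \<and> (\<forall>e\<in>arcs G. pE (hE e) = pE e)"

definition finite_regular_cover ::
    "('v, 'e) pre_digraph \<Rightarrow> ('w, 'f) pre_digraph \<Rightarrow> ('v \<Rightarrow> 'w) \<Rightarrow> ('e \<Rightarrow> 'f) \<Rightarrow> bool" where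
  "finite_regular_cover G R pV pE \<longleftrightarrow>
     covering_map G R pV pE \<and> Digraph_Component.connected G \<and>
     (\<forall>w\<in>verts R. finite {v \<in> verts G. pV v = w}) \<and>
     (\<forall>u\<in>verts G. \<forall>v\<in>verts G. pV u = pV v \<longrightarrow>
        (\<exists>hV hE. deck_transformation G pV pE hV hE \<and> hV u = v))"

fun edge_path :: "('v, 'e) pre_digraph \<Rightarrow> 'v \<Rightarrow> 'e word \<Rightarrow> 'v \<Rightarrow> bool" where
  "edge_path G u [] v \<longleftrightarrow> u \<in> verts G \<and> u = v"
| "edge_path G u ((e, True) # p) v \<longleftrightarrow> e \<in> arcs G \<and> tail G e = u \<and> edge_path G (head G e) p v"
| "edge_path G u ((e, False) # p) v \<longleftrightarrow> e \<in> arcs G \<and> head G e = u \<and> edge_path G (tail G e) p v"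

text \<open>
  The fundamental group of a cover \<open>G\<close> of the rose at the vertex \<open>u\<close>, identified with its image in
  the free group: the loop \<open>i\<close> of the rose is the generator \<open>i\<close>, and homotopy of edge paths is free
  reduction.
\<close>

definition cover_pi1 :: "('v, 'e) pre_digraph \<Rightarrow> ('e \<Rightarrow> nat) \<Rightarrow> 'v \<Rightarrow> nat word set" where
  "cover_pi1 G pE u = {free_reduce (map (apfst pE) p) | p. edge_path G u p u}"


section \<open>The separability complex\<close>

definition conj_class :: "('a, 'b) monoid_scheme \<Rightarrow> 'a \<Rightarrow> 'a set" where
  "conj_class K g = {h \<otimes>\<^bsub>K\<^esub> g \<otimes>\<^bsub>K\<^esub> inv\<^bsub>K\<^esub> h | h. h \<in> carrier K}"

text \<open>
  An arc is a triple consisting of its initial vertex, its label and its terminal vertex, so arcs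
  with the same end points but different labels are different.
\<close>

definition separability_complex ::
    "('a, 'b) monoid_scheme \<Rightarrow> 'a set \<Rightarrow> ('a set, 'a set \<times> 'a set \<times> 'a set) pre_digraph" where
  "separability_complex K H =
     \<lparr> verts = conj_class K ` H,
       arcs = {(V, A, W). V \<in> conj_class K ` H \<and> W \<in> conj_class K ` H \<and>
                 A \<in> conj_class K ` (separable_elements K \<inter> H - {\<one>\<^bsub>K\<^esub>}) \<and>
                 (\<exists>v\<in>V. \<exists>a\<in>A. \<exists>w\<in>W. w = v \<otimes>\<^bsub>K\<^esub> a)},
       tail = (\<lambda>(V, A, W). V),
       head = (\<lambda>(V, A, W). W) \<rparr>"

lemma wf_digraph_separability_complex: "wf_digraph (separability_complex K H)"
  by unfold_locales (auto simp: separability_complex_def)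

definition SC :: "nat \<Rightarrow> ('v, 'e) pre_digraph \<Rightarrow> ('e \<Rightarrow> nat) \<Rightarrow> 'v
    \<Rightarrow> (nat word set, nat word set \<times> nat word set \<times> nat word set) pre_digraph" where
  "SC n G pE u = separability_complex (free_group {1..n}) (cover_pi1 G pE u)"

definition connected_component_of_graph ::
    "('v, 'e) pre_digraph \<Rightarrow> ('v, 'e) pre_digraph \<Rightarrow> bool" where
  "connected_component_of_graph G C \<longleftrightarrow>
     pre_digraph.max_subgraph G Digraph_Component.connected C"

text \<open>
  The path metric: each arc has length one and may be crossed in either direction.
\<close>

definition path_dist :: "('v, 'e) pre_digraph \<Rightarrow> 'v \<Rightarrow> 'v \<Rightarrow> ereal" where
  "path_dist G u v = wf_digraph.\<mu> (with_proj (mk_symmetric G)) (\<lambda>_. 1) u v"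

definition graph_diameter :: "('v, 'e) pre_digraph \<Rightarrow> ereal" where
  "graph_diameter G = (SUP (u, v) \<in> verts G \<times> verts G. path_dist G u v)"

end

theory Submission
  imports Defs "HOL-Library.Sublist"
begin

text \<open>
  Separable elements are detected by a quasimorphism.  For a word \<open>p\<close>, Brooks' function counts the
  occurrences of \<open>p\<close> minus those of \<open>p\<inverse>\<close> in a reduced word; it is a quasimorphism, hence changes
  by a bounded amount under conjugation.  If \<open>p\<close> contains all cyclically consecutive letters of
  \<open>x\<^sub>1\<^sup>2 \<dots> x\<^sub>n\<^sup>2\<close>, it is bounded on separable elements by the following form of Whitehead's
  cut vertex lemma.

  Let \<open>F * G\<close> be a free splitting and \<open>E\<close> the set of elements whose normal form begins in \<open>F\<close>.
  Multiplying on the right by a generator changes membership in \<open>E\<close> only finitely often, so the ends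
  of the Cayley tree are coloured by \<open>E\<close> and its complement, and both ends of every translate of the
  axis of an element of \<open>F\<close> have the same colour.  At a deepest vertex beyond which both colours
  occur, every direction pointing away from the root is monochromatic.  If a cyclically reduced
  conjugate of an element of \<open>F\<close> contained \<open>p\<close>, the translates of its axis through that vertex would
  join all \<open>2 n\<close> directions in a cycle; at most one direction points to the root, and deleting it
  leaves the cycle connected, so all the other directions would have one colour, a contradiction.

  Finally, \<open>\<pi>\<^sub>1(\<Gamma>)\<close> contains separable powers \<open>x\<^sub>i ^ m\<^sub>i\<close> with \<open>m\<^sub>i \<ge> 2\<close>.  For their product \<open>q\<close>
  and \<open>p = q q\<close>, all classes \<open>[v q\<^sup>k]\<close> lie in the component of \<open>[v]\<close>, while the values of the
  quasimorphism on them are unbounded, and each edge changes the value by a bounded amount.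
\<close>

section \<open>Words and the Brooks counting quasimorphism\<close>

lemma reduced_append:
  "reduced (u @ v) \<longleftrightarrow> reduced u \<and> reduced v \<and> (u \<noteq> [] \<longrightarrow> v \<noteq> [] \<longrightarrow> hd v \<noteq> inv_letter (last u))"
  by (auto simp: reduced_def successively_append_iff)

lemma reduced_Cons:
  "reduced (a # w) \<longleftrightarrow> reduced w \<and> (w \<noteq> [] \<longrightarrow> hd w \<noteq> inv_letter a)"
  using reduced_append[of "[a]" w] by (auto simp: reduced_def)

lemma reduced_snoc:
  "reduced (w @ [a]) \<longleftrightarrow> reduced w \<and> (w \<noteq> [] \<longrightarrow> a \<noteq> inv_letter (last w))"
  using reduced_append[of w "[a]"] by (auto simp: reduced_def)

lemma inv_letter_eq_iff [simp]: "inv_letter a = inv_letter b \<longleftrightarrow> a = b"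
  by (metis inv_letter_inv_letter)

lemma inv_word_simps [simp]:
  "inv_word [] = []" "inv_word (a # w) = inv_word w @ [inv_letter a]"
  "inv_word (u @ v) = inv_word v @ inv_word u"
  "inv_word (inv_word u) = u" "length (inv_word u) = length u"
  "inv_word u = [] \<longleftrightarrow> u = []"
  by (simp_all add: inv_word_def rev_map o_def)

lemma set_inv_word [simp]: "set (inv_word u) = inv_letter ` set u"
  by (simp add: inv_word_def)

lemma fst_set_inv_word [simp]: "fst ` set (inv_word u) = fst ` set u"
  by (simp add: image_image)

lemma last_inv_word: "u \<noteq> [] \<Longrightarrow> last (inv_word u) = inv_letter (hd u)"
  by (cases u) simp_all

lemma reduced_inv_word [simp]: "reduced (inv_word u) \<longleftrightarrow> reduced u"
proof -
  have *: "reduced (inv_word w)" if "reduced w" for w :: "'a word"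
    using that
  proof (induction w)
    case (Cons a w)
    then show ?case
      by (cases "w = []") (auto simp: reduced_Cons reduced_snoc last_inv_word)
  qed simp
  show ?thesis using *[of u] *[of "inv_word u"] by auto
qed

lemma free_reduce_cancel: "free_reduce (u @ a # inv_letter a # v) = free_reduce (u @ v)"
  using red_cons_cancel[of "free_reduce v" a] by (simp add: free_reduce_def reduced_foldr)

lemma free_reduce_cancel_word: "free_reduce (u @ w @ inv_word w @ v) = free_reduce (u @ v)"
proof (induction w arbitrary: u v)
  case (Cons a w)
  show ?case using Cons[of "u @ [a]" "inv_letter a # v"] by (simp add: free_reduce_cancel)
qed simp

lemma free_reduce_cancel_word': "free_reduce (u @ inv_word w @ w @ v) = free_reduce (u @ v)"
  using free_reduce_cancel_word[of u "inv_word w" v] by simp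

text \<open>Cancellation happens only at the junction and removes a suffix \<open>t\<close> of
  \<open>u\<close> against its inverse at the front of \<open>v\<close>. The induction takes off the
  last letter of \<open>u\<close> as long as the junction is not reduced.\<close>

lemma cancellation:
  assumes "reduced u" "reduced v"
  obtains u' t v' where "u = u' @ t" "v = inv_word t @ v'" "free_reduce (u @ v) = u' @ v'"
proof -
  have "\<exists>u' t v'. u = u' @ t \<and> v = inv_word t @ v' \<and> free_reduce (u @ v) = u' @ v'"
    using assms
  proof (induction u arbitrary: v rule: rev_induct)
    case Nil
    then show ?case by (intro exI[of _ "[]"] exI[of _ v]) (auto simp: free_reduce_reduced)
  next
    case (snoc a u)
    show ?case
    proof (cases "reduced ((u @ [a]) @ v)")
      case True
      then show ?thesis by (intro exI[of _ "u @ [a]"] exI[of _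
          "[]"] exI[of _ v]) (auto simp: free_reduce_reduced)
    next
      case False
      then have "v \<noteq> []" "hd v = inv_letter a" using snoc.prems reduced_append[of "u @ [a]" v]
        by auto
      then obtain v0 where v: "v = inv_letter a # v0" by (cases v) auto
      have "reduced u" "reduced v0" using snoc.prems v by (auto simp: reduced_snoc reduced_Cons)
      from snoc.IH[OF this] obtain u' t v'
        where *: "u = u' @ t" "v0 = inv_word t @ v'" "free_reduce (u @ v0) = u' @ v'" by blast
      have "free_reduce ((u @ [a]) @ v) = free_reduce (u @ v0)"
        by (simp add: v free_reduce_cancel)
      with * v show ?thesis by (intro exI[of _ u'] exI[of _ "t @ [a]"] exI[of _ v']) auto
    qed
  qed
  then show ?thesis using that by blast
qed

text \<open>A reduced square says at once that \<open>c\<close> is reduced and that its last letter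
  does not cancel its first. The empty word is excluded so that powers grow in length.\<close>

definition cyclically_reduced :: "'x word \<Rightarrow> bool" where
  "cyclically_reduced c \<longleftrightarrow> c \<noteq> [] \<and> reduced (c @ c)"

text \<open>Mutually inverse letters are peeled off the two ends until none are left. The resulting
  equation is one of words, without any reduction.\<close>

lemma cyclic_decomposition:
  assumes "reduced a" "a \<noteq> []"
  obtains g c where "a = g @ c @ inv_word g" "cyclically_reduced c"
proof -
  have "\<exists>g c. a = g @ c @ inv_word g \<and> cyclically_reduced c"
    using assms
  proof (induction "length a" arbitrary: a rule: less_induct)
    case less
    show ?case
    proof (cases "hd a = inv_letter (last a)")
      case False
      then have "cyclically_reduced a" using less.prems
        by (simp add: cyclically_reduced_def reduced_append)
      then show ?thesis by (intro exI[of _ "[]"] exI[of _ a]) auto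
    next
      case True
      obtain x a1 where a1: "a = x # a1" using less.prems by (cases a) auto
      have "a1 \<noteq> []" using True a1 by (cases a1) (auto dest: sym)
      then obtain a0 y where a0: "a1 = a0 @ [y]" by (cases a1 rule: rev_cases) auto
      have y: "y = inv_letter x" using True a1 a0 by simp
      \<comment> \<open>An empty core would leave a letter followed by its inverse, which is not
        reduced.\<close>
      have "a0 \<noteq> []" using less.prems(1) a1 a0 y by (auto simp: reduced_Cons)
      moreover have "reduced a0" using less.prems(1) a1 a0 by (auto simp: reduced_Cons reduced_snoc)
      ultimately obtain g c where "a0 = g @ c @ inv_word g" "cyclically_reduced c"
        using less.hyps[of a0] a1 a0 by auto
      then show ?thesis using a1 a0 y by (intro exI[of _ "x # g"] exI[of _ c]) auto
    qed
  qed
  then show ?thesis using that by blast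
qed

lemma cyclically_reduced_inv_word: "cyclically_reduced c \<Longrightarrow> cyclically_reduced (inv_word c)"
  unfolding cyclically_reduced_def by (metis inv_word_simps(3,6) reduced_inv_word)

lemma cyclically_reduced_rotate: "cyclically_reduced (u @ v) \<Longrightarrow> cyclically_reduced (v @ u)"
  by (cases "u = []"; cases "v = []") (auto simp: cyclically_reduced_def reduced_append)

abbreviation word_power :: "'a list \<Rightarrow> nat \<Rightarrow> 'a list" where
  "word_power w k \<equiv> concat (replicate k w)"

lemma word_power_Suc_right: "word_power w (Suc k) = word_power w k @ w"
  by (induction k) auto

lemma hd_word_power: "w \<noteq> [] \<Longrightarrow> k > 0 \<Longrightarrow> hd (word_power w k) = hd w"
  by (cases k) auto

lemma last_word_power: "w \<noteq> [] \<Longrightarrow> k > 0 \<Longrightarrow> last (word_power w k) = last w"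
  by (cases k) (auto simp: word_power_Suc_right simp del: replicate.simps)

lemma reduced_word_power:
  assumes "cyclically_reduced c" shows "reduced (word_power c k)"
proof (induction k)
  case (Suc k)
  then show ?case using assms by (cases "k = 0") (auto simp: cyclically_reduced_def reduced_append
      hd_word_power)
qed simp

lemma reduced_append_word_power:
  assumes "cyclically_reduced c" "reduced (u @ c @ v)" "k > 0"
  shows "reduced (u @ word_power c k @ v)"
  using assms reduced_word_power[OF assms(1), of k]
  by (auto simp: cyclically_reduced_def reduced_append hd_word_power last_word_power)

section \<open>Counting subwords\<close>

fun occurrences :: "'a list \<Rightarrow> 'a list \<Rightarrow> nat" where
  "occurrences p [] = 0"
| "occurrences p (a # w) = (if prefix p (a # w) then 1 else 0) + occurrences p w"

text \<open>Here occurrences are counted by their last position; inversion reverses words, so it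
  exchanges this count with the one by first position.\<close>

lemma occurrences_snoc:
  assumes "p \<noteq> []"
  shows "occurrences p (w @ [a]) = occurrences p w + (if suffix p (w @ [a]) then 1 else 0)"
proof (induction w)
  case Nil
  then show ?case using assms by (cases p) (auto simp: suffix_Cons)
next
  case (Cons b w)
  have 1: "prefix p (b # w @ [a]) \<longleftrightarrow> prefix p (b # w) \<or> p = b # w @ [a]"
    using prefix_snoc[of p "b # w" a] by auto
  have 2: "suffix p (b # w @ [a]) \<longleftrightarrow> suffix p (w @ [a]) \<or> p = b # w @ [a]"
    by (auto simp: suffix_Cons)
  have "\<not> prefix (b # w @ [a]) (b # w)" "\<not> suffix (b # w @ [a]) (w @ [a])"
    by (auto dest: prefix_length_le suffix_length_le)
  then show ?case using Cons 1 2 by auto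
qed

lemma occurrences_inv_word:
  assumes "p \<noteq> []"
  shows "occurrences (inv_word p) (inv_word w) = occurrences p w"
proof (induction w)
  case (Cons a w)
  have "suffix (inv_word p) (inv_word w @ [inv_letter a]) \<longleftrightarrow> prefix p (a # w)"
  proof
    assume "suffix (inv_word p) (inv_word w @ [inv_letter a])"
    then obtain s where "inv_word (a # w) = s @ inv_word p" by (auto simp: suffix_def)
    then have "a # w = p @ inv_word s" by (metis inv_word_simps(3,4))
    then show "prefix p (a # w)" by (simp add: prefix_def)
  next
    assume "prefix p (a # w)"
    then obtain s where "a # w = p @ s" by (auto simp: prefix_def)
    then have "inv_word (a # w) = inv_word s @ inv_word p" by simp
    then show "suffix (inv_word p) (inv_word w @ [inv_letter a])" by (auto simp: suffix_def)
  qed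
  then show ?case using Cons assms by (simp add: occurrences_snoc)
qed simp

lemma occurrences_append_ge: "occurrences p u + occurrences p v \<le> occurrences p (u @ v)"
proof (induction u)
  case (Cons a u)
  have "prefix p (a # u) \<Longrightarrow> prefix p (a # u @ v)" by (metis append_Cons prefix_prefix)
  then show ?case using Cons by auto
qed simp

text \<open>An additional occurrence straddles the junction, so it starts among the last
  \<open>length p\<close> letters of \<open>u\<close>.\<close>

lemma occurrences_append_le:
  "occurrences p (u @ v) \<le> occurrences p u + occurrences p v + min (length u) (length p)"
proof (induction u)
  case (Cons a u)
  show ?case
  proof (cases "length (a # u) \<le> length p")
    case False
    then have "prefix p (a # u @ v) \<longleftrightarrow> prefix p (a # u)"
      using prefix_append[of p "a # u" v] by (auto simp: prefix_def append_eq_append_conv2)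
    with Cons False show ?thesis by auto
  qed (use Cons in auto)
qed simp

lemma occurrences_eq_0: "\<not> sublist p w \<Longrightarrow> occurrences p w = 0"
  by (induction w) (auto simp: sublist_Cons_right)

definition brooks :: "'x word \<Rightarrow> 'x word \<Rightarrow> int" where
  "brooks p w = int (occurrences p w) - int (occurrences (inv_word p) w)"

lemma brooks_inv_word: "p \<noteq> [] \<Longrightarrow> brooks p (inv_word w) = - brooks p w"
  using occurrences_inv_word[of p w] occurrences_inv_word[of "inv_word p" w]
  by (simp add: brooks_def)

text \<open>Both counts are superadditive with an excess between \<open>0\<close> and
  \<open>length p\<close>, so the two excesses differ by at most \<open>length p\<close>.\<close>

lemma brooks_append: "\<bar>brooks p (u @ v) - brooks p u - brooks p v\<bar> \<le> int (length p)"
  using occurrences_append_ge[of p u v] occurrences_append_ge[of "inv_word p" u v]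
    occurrences_append_le[of p u v] occurrences_append_le[of "inv_word p" u v]
  unfolding brooks_def by simp

text \<open>The cancelled word \<open>t\<close> and its inverse contribute opposite values, and the
  junctions in \<open>u' @ t\<close>, \<open>inv_word t @ v'\<close> and \<open>u' @ v'\<close> cost
  at most \<open>length p\<close> each.\<close>

lemma brooks_quasimorphism:
  assumes "p \<noteq> []" "reduced u" "reduced v"
  shows "\<bar>brooks p (free_reduce (u @ v)) - brooks p u - brooks p v\<bar> \<le> 3 * int (length p)"
proof -
  obtain u' t v' where *: "u = u' @ t" "v = inv_word t @ v'" "free_reduce (u @ v) = u' @ v'"
    using cancellation[OF assms(2,3)] .
  show ?thesis
    using brooks_append[of p u' t] brooks_append[of p "inv_word t" v'] brooks_append[of p u' v']
      brooks_inv_word[OF assms(1), of t]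
    unfolding *(3) unfolding *(1,2) by linarith
qed

text \<open>The values at \<open>h\<close> and at its inverse cancel, which leaves the errors of two
  products.\<close>

lemma brooks_conjugate:
  assumes "p \<noteq> []" "reduced h" "reduced g"
  shows "\<bar>brooks p (free_reduce (h @ g @ inv_word h)) - brooks p g\<bar> \<le> 6 * int (length p)"
proof -
  have "free_reduce (free_reduce (h @ g) @ inv_word h) = free_reduce (h @ g @ inv_word h)" by simp
  then show ?thesis
    using brooks_quasimorphism[OF assms] brooks_inv_word[OF assms(1), of h]
      brooks_quasimorphism[OF assms(1) reduced_free_reduce, of "inv_word h" "h @ g"] assms(2)
    by simp
qed

section \<open>The two sides of a free splitting\<close>

text \<open>The empty sequence is excluded, which puts \<open>\<one>\<close> into the
  complement.\<close>

definition starts_in_left :: "('a, 'b) monoid_scheme \<Rightarrow> 'a set \<Rightarrow> 'a set \<Rightarrow> 'a set" where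
  "starts_in_left K F G =
     seq_product K ` {s \<in> free_product_seqs K F G. s \<noteq> [] \<and> fst (hd s)}"

locale free_splitting = group K for K (structure) +
  fixes F G :: "'a set"
  assumes splitting: "internal_free_product K F G"
begin

abbreviation "E \<equiv> starts_in_left K F G"

definition factor :: "bool \<Rightarrow> 'a set" where
  "factor t = (if t then F else G)"

lemma subgroup_factor: "subgroup (factor t) K"
  using splitting by (auto simp: internal_free_product_def factor_def)

lemma factor_carrier: "g \<in> factor t \<Longrightarrow> g \<in> carrier K"
  using subgroup.mem_carrier[OF subgroup_factor] .

lemma seqs_iff:
  "s \<in> free_product_seqs K F G \<longleftrightarrow>
     (\<forall>a\<in>set s. snd a \<in> factor (fst a) - {\<one>}) \<and> successively (\<lambda>a b. fst a \<noteq> fst b) s"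
  by (simp add: free_product_seqs_def factor_def case_prod_beta)

lemma seq_product_Nil [simp]: "seq_product K [] = \<one>"
  by (simp add: seq_product_def)

lemma seq_product_Cons [simp]: "seq_product K (a # s) = snd a \<otimes> seq_product K s"
  by (simp add: seq_product_def)

lemma seq_product_closed: "\<forall>a\<in>set s. snd a \<in> carrier K \<Longrightarrow> seq_product K s \<in> carrier K"
  by (induction s) auto

lemma seq_product_snoc:
  "\<forall>a\<in>set s. snd a \<in> carrier K \<Longrightarrow> snd a \<in> carrier K \<Longrightarrow>
     seq_product K (s @ [a]) = seq_product K s \<otimes> snd a"
  by (induction s) (auto simp: m_assoc seq_product_closed)

lemma obtain_seq:
  assumes "g \<in> carrier K"
  obtains s where "s \<in> free_product_seqs K F G" "g = seq_product K s"
  using assms splitting by (auto simp: internal_free_product_def bij_betw_def)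

lemma seq_product_in_left_iff:
  assumes "s \<in> free_product_seqs K F G"
  shows "seq_product K s \<in> E \<longleftrightarrow> s \<noteq> [] \<and> fst (hd s)"
proof
  assume "seq_product K s \<in> E"
  then obtain s' where s': "s' \<in> free_product_seqs K F G" "s' \<noteq> [] \<and> fst (hd s')"
    "seq_product K s = seq_product K s'" by (auto simp: starts_in_left_def)
  moreover have "inj_on (seq_product K) (free_product_seqs K F G)"
    using splitting by (auto simp: internal_free_product_def bij_betw_def)
  ultimately have "s = s'" using assms by (auto dest: inj_onD)
  with s' show "s \<noteq> [] \<and> fst (hd s)" by simp
qed (use assms in \<open>auto simp: starts_in_left_def\<close>)

lemma factor_in_left_iff:
  assumes "g \<in> factor t" "g \<noteq> \<one>" shows "g \<in> E \<longleftrightarrow> t"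
  using seq_product_in_left_iff[of "[(t, g)]"] assms factor_carrier[OF assms(1)]
  by (simp add: seqs_iff)

text \<open>Right multiplication by \<open>y\<close> touches only the last syllable of the normal
  form: a syllable is appended, changed or deleted. The tag of the first syllable survives as long
  as the result is nontrivial.\<close>

lemma mult_factor_in_left_iff:
  assumes g: "g \<in> carrier K" "g \<noteq> \<one>" and y: "y \<in> factor t" "g \<otimes> y \<noteq> \<one>"
  shows "g \<otimes> y \<in> E \<longleftrightarrow> g \<in> E"
proof (cases "y = \<one>")
  case False
  obtain s where s: "s \<in> free_product_seqs K F G" "g = seq_product K s"
    using obtain_seq g(1) by blast
  then have "s \<noteq> []" using g(2) by auto
  then obtain s0 t' f where s0: "s = s0 @ [(t', f)]" by (cases s rule: rev_cases) auto
  have car: "\<forall>a\<in>set s0. snd a \<in> carrier K" "f \<in> carrier K" "y \<in> carrier K"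
    using s(1) s0 y(1) factor_carrier by (auto simp: seqs_iff)
  have gs: "g = seq_product K s0 \<otimes> f" using s s0 car by (simp add: seq_product_snoc)
  have "\<exists>s'. s' \<in> free_product_seqs K F G \<and> seq_product K s' = g \<otimes> y \<and> s' \<noteq> [] \<and> fst (hd s') =
      fst (hd s)"
  proof (cases "t' = t")
    case False
    have "seq_product K (s @ [(t, y)]) = g \<otimes> y" using s s0 car by (subst seq_product_snoc) auto
    moreover have "s @ [(t, y)] \<in> free_product_seqs K F G"
      using False s s0 y \<open>y \<noteq> \<one>\<close> by (auto simp: seqs_iff successively_append_iff)
    ultimately show ?thesis using \<open>s \<noteq> []\<close> by (intro exI[of _ "s @ [(t, y)]"]) simp
  next
    case True
    show ?thesis
    proof (cases "f \<otimes> y = \<one>")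
      case False
      have "f \<otimes> y \<in> factor t" using s s0 y True subgroup.m_closed[OF subgroup_factor]
        by (auto simp: seqs_iff)
      then show ?thesis using s s0 car y True False
        by (intro exI[of _ "s0 @ [(t, f \<otimes> y)]"])
          (auto simp: seqs_iff seq_product_snoc successively_append_iff gs hd_append m_assoc
              seq_product_closed)
    next
      case True
      \<comment> \<open>The last syllable disappears, and \<open>s0\<close> is nonempty because its
        product is not \<open>\<one>\<close>.\<close>
      have "g \<otimes> y = seq_product K s0" using True car by (simp add: gs m_assoc seq_product_closed)
      then show ?thesis using s s0 y(2)
        by (intro exI[of _ s0]) (auto simp: seqs_iff successively_append_iff hd_append)
    qed
  qed
  then show ?thesis using s \<open>s \<noteq> []\<close> seq_product_in_left_iff by metis
qed (use g in simp)

text \<open>Induction on the syllables of \<open>y\<close>: passing from \<open>g\<close> to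
  \<open>g \<otimes> snd a\<close> can change sides only if one of the two is \<open>\<one>\<close>,
  and every other change is a translate of one for the remaining product.\<close>

lemma finite_left_coboundary:
  assumes "y \<in> carrier K"
  shows "finite {g \<in> carrier K. (g \<otimes> y \<in> E) \<noteq> (g \<in> E)}"
proof -
  obtain s where "s \<in> free_product_seqs K F G" "y = seq_product K s"
    using obtain_seq assms by blast
  then have "\<forall>a\<in>set s. snd a \<in> factor (fst a)" "y = seq_product K s" by (auto simp: seqs_iff)
  then show ?thesis
  proof (induction s arbitrary: y)
    case Nil
    then have "{g \<in> carrier K. (g \<otimes> y \<in> E) \<noteq> (g \<in> E)} = {}" by auto
    then show ?case by (simp only: finite.emptyI)
  next
    case (Cons a s)
    let ?z = "seq_product K s"
    have a: "snd a \<in> factor (fst a)" "snd a \<in> carrier K" and z: "?z \<in> carrier K"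
      using Cons.prems factor_carrier by (auto intro!: seq_product_closed)
    have "{g \<in> carrier K. (g \<otimes> y \<in> E) \<noteq> (g \<in> E)} \<subseteq>
      {\<one>, inv (snd a)} \<union> (\<lambda>h. h \<otimes> inv (snd a)) ` {g \<in> carrier K. (g \<otimes> ?z \<in> E) \<noteq> (g \<in> E)}"
    proof
      fix g assume g: "g \<in> {g \<in> carrier K. (g \<otimes> y \<in> E) \<noteq> (g \<in> E)}"
      let ?h = "g \<otimes> snd a"
      have gy: "g \<otimes> y = ?h \<otimes> ?z" using g a z Cons.prems by (simp add: m_assoc)
      have gh: "g = ?h \<otimes> inv (snd a)" using g a by (simp add: m_assoc)
      show "g \<in> {\<one>, inv (snd a)} \<union> (\<lambda>h. h \<otimes> inv (snd a)) ` {g \<in> carrier K. (g \<otimes> ?z \<in> E) \<noteq> (g \<in> E)}"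
      proof (cases "g = \<one> \<or> ?h = \<one>")
        case True
        then show ?thesis using g a inv_equality[of g "snd a"] by auto
      next
        case False
        then have "?h \<in> E \<longleftrightarrow> g \<in> E" using mult_factor_in_left_iff[of g "snd a"] g a by auto
        then have "?h \<in> {g \<in> carrier K. (g \<otimes> ?z \<in> E) \<noteq> (g \<in> E)}" using g a gy by auto
        then show ?thesis using gh by blast
      qed
    qed
    moreover have "finite {g \<in> carrier K. (g \<otimes> ?z \<in> E) \<noteq> (g \<in> E)}"
      using Cons.IH[of ?z] Cons.prems by auto
    ultimately show ?case by (meson finite.simps finite_UnI finite_imageI finite_subset)
  qed
qed

text \<open>The side on which the orbit \<open>h f\<^sup>k g\<close> finally stays depends neither on \<open>f\<close> nor on \<open>g\<close>,
  so both ends of a translated axis of \<open>f\<close> lie on the same side.\<close>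

lemma left_power_eventually:
  assumes f: "f \<in> F" and inj: "inj (\<lambda>k::nat. f [^] k)" and h: "h \<in> carrier K" and g: "g \<in> carrier K"
  shows "finite {k::nat. (h \<otimes> f [^] k \<otimes> g \<in> E) \<noteq> (h \<in> E \<union> F)}"
proof -
  have fF: "f \<in> factor True" "f \<in> carrier K" using f factor_carrier[of f True]
    by (auto simp: factor_def)
  have fk: "f [^] k \<in> factor True" "f [^] k \<in> carrier K" for k :: nat
  proof -
    show "f [^] k \<in> carrier K" using fF by simp
    show "f [^] k \<in> factor True"
      using fF subgroup.one_closed[OF subgroup_factor, of True] subgroup.m_closed[OF
          subgroup_factor, of _ True]
      by (induction k) auto
  qed
  \<comment> \<open>By injectivity only finitely many \<open>k\<close> meet a finite exceptional
    set.\<close>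
  have inj': "inj (\<lambda>k::nat. h \<otimes> f [^] k)"
    using inj h fk by (auto simp: inj_def)
  have "{k::nat. (h \<otimes> f [^] k \<otimes> g \<in> E) \<noteq> (h \<in> E \<union> F)} \<subseteq>
      (\<lambda>k. h \<otimes> f [^] k) -` ({x \<in> carrier K. (x \<otimes> g \<in> E) \<noteq> (x \<in> E)} \<union> {\<one>})"
  proof
    fix k :: nat assume k: "k \<in> {k. (h \<otimes> f [^] k \<otimes> g \<in> E) \<noteq> (h \<in> E \<union> F)}"
    show "k \<in> (\<lambda>k. h \<otimes> f [^] k) -` ({x \<in> carrier K. (x \<otimes> g \<in> E) \<noteq> (x \<in> E)} \<union> {\<one>})"
    proof (cases "h \<otimes> f [^] k = \<one>")
      case False
      \<comment> \<open>The union with \<open>F\<close> serves the case \<open>h = \<one>\<close>: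
        it lies outside \<open>E\<close>, while the nontrivial powers of \<open>f\<close> lie in
        \<open>E\<close>.\<close>
      have "h \<otimes> f [^] k \<in> E \<longleftrightarrow> h \<in> E \<union> F"
      proof (cases "h \<in> F")
        case True
        then have "h \<otimes> f [^] k \<in> factor True"
          using fk(1)[of k] subgroup.m_closed[OF subgroup_factor, of h True]
          by (simp add: factor_def)
        then show ?thesis using factor_in_left_iff False True by blast
      next
        case hF: False
        then have "h \<noteq> \<one>" using subgroup.one_closed[OF subgroup_factor, of True]
          by (auto simp: factor_def)
        then show ?thesis using hF mult_factor_in_left_iff[OF h _ fk(1) False] by simp
      qed
      then show ?thesis using k h fk(2)[of k] by auto
    qed simp
  qed
  moreover have "finite ((\<lambda>k::nat. h \<otimes> f [^] k) -` ({x \<in> carrier K. (x \<otimes> g \<in> E) \<noteq> (x \<in> E)} \<union> {\<one>}))"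
    using finite_left_coboundary[OF g] inj' by (intro finite_vimageI) auto
  ultimately show ?thesis by (rule finite_subset)
qed

end

section \<open>Colouring the directions at a vertex of the Cayley tree\<close>

lemma free_group_simps [simp]:
  "w \<in> carrier (free_group X) \<longleftrightarrow> reduced w \<and> fst ` set w \<subseteq> X"
  "u \<otimes>\<^bsub>free_group X\<^esub> v = free_reduce (u @ v)"
  "\<one>\<^bsub>free_group X\<^esub> = []"
  by (simp_all add: free_group_def)

lemma fst_set_free_reduce: "fst ` set w \<subseteq> X \<Longrightarrow> fst ` set (free_reduce w) \<subseteq> X"
  by (rule order_trans[OF image_mono[OF set_free_reduce]])

lemma inv_free_group:
  "u \<in> carrier (free_group X) \<Longrightarrow> inv\<^bsub>free_group X\<^esub> u = inv_word u"
  by (rule group.inv_equality[OF group_free_group])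
     (auto simp: free_reduce_inv_word image_subset_iff)

lemma free_group_pow:
  "a \<in> carrier (free_group X) \<Longrightarrow> a [^]\<^bsub>free_group X\<^esub> (k::nat) = free_reduce (word_power a k)"
proof (induction k)
  case (Suc k)
  then show ?case by (simp add: word_power_Suc_right nat_pow_def del: replicate.simps)
qed (simp add: free_reduce_def nat_pow_def)

lemma free_reduce_power_conjugate:
  "free_reduce (word_power (g @ c @ inv_word g) k) = free_reduce (g @ word_power c k @ inv_word g)"
proof (induction k)
  case 0
  then show ?case using free_reduce_cancel_word[of "[]" g "[]"] by simp
next
  case (Suc k)
  have "free_reduce (word_power (g @ c @ inv_word g) (Suc k)) =
      free_reduce (free_reduce (word_power (g @ c @ inv_word g) k) @ g @ c @ inv_word g)"
    by (simp add: word_power_Suc_right del: replicate.simps)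
  also have "\<dots> = free_reduce ((g @ word_power c k) @ inv_word g @ g @ c @ inv_word g)"
    unfolding Suc free_reduce_append_left by simp
  also have "\<dots> = free_reduce (g @ word_power c (Suc k) @ inv_word g)"
    unfolding free_reduce_cancel_word' by (simp add: word_power_Suc_right del: replicate.simps)
  finally show ?case .
qed

text \<open>For a conjugate of a cyclically reduced word \<open>c\<close> by \<open>g\<close>, the
  powers have strictly increasing lengths \<open>2 * length g + k * length c\<close>, so free groups
  are torsion-free.\<close>

lemma inj_free_group_pow:
  assumes "a \<in> carrier (free_group X)" "a \<noteq> []"
  shows "inj (\<lambda>k::nat. a [^]\<^bsub>free_group X\<^esub> k)"
proof -
  obtain g c where a: "a = g @ c @ inv_word g" "cyclically_reduced c"
    using cyclic_decomposition assms by (metis free_group_simps(1))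
  have len: "length (a [^]\<^bsub>free_group X\<^esub> k) = (if k = 0 then 0 else 2 * length g + k * length c)"
      for k :: nat
  proof (cases "k = 0")
    case False
    have "a [^]\<^bsub>free_group X\<^esub> k = free_reduce (g @ word_power c k @ inv_word g)"
      using free_group_pow[OF assms(1)] free_reduce_power_conjugate a(1) by metis
    also have "\<dots> = g @ word_power c k @ inv_word g"
      using reduced_append_word_power[OF a(2), of g "inv_word g" k] False assms a
      by (intro free_reduce_reduced) simp
    finally show ?thesis using False by (simp add: length_concat sum_list_replicate)
  qed simp
  have "length c > 0" using a(2) by (simp add: cyclically_reduced_def)
  then show ?thesis
  proof (intro injI)
    fix j k :: nat
    assume c: "length c > 0" and "a [^]\<^bsub>free_group X\<^esub> j = a [^]\<^bsub>free_group X\<^esub> k"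
    then have "(if j = 0 then 0 else 2 * length g + j * length c) =
        (if k = 0 then 0 else 2 * length g + k * length c)" using len by metis
    with c show "j = k" by (auto split: if_splits)
  qed
qed

text \<open>In the Cayley tree with root \<open>[]\<close>, these are the vertices whose geodesic to
  the root passes through \<open>v\<close>.\<close>

definition shadow :: "'x set \<Rightarrow> 'x word \<Rightarrow> 'x word set" where
  "shadow X v = {w \<in> carrier (free_group X). prefix v w}"

text \<open>The directions at \<open>v\<close> that lead away from the root. For nonempty
  \<open>v\<close> exactly one direction is missing, the inverse of the last letter.\<close>

definition outward :: "'x set \<Rightarrow> 'x word \<Rightarrow> 'x \<times> bool \<Rightarrow> bool" where
  "outward X v z \<longleftrightarrow> fst z \<in> X \<and> reduced (v @ [z])"

text \<open>Take a deepest vertex \<open>v\<close> of the Cayley tree whose shadow meets both \<open>E\<close> and its complement in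
  infinitely many vertices.\<close>

lemma branching_vertex:
  fixes X :: "'x set"
  assumes X: "finite X"
    and cob: "\<And>z. fst z \<in> X \<Longrightarrow> finite {g \<in> carrier (free_group X). (free_reduce (g @ [z]) \<in> E) \<noteq>
        (g \<in> E)}"
    and inf: "infinite (carrier (free_group X) \<inter> E)" "infinite (carrier (free_group X) - E)"
  obtains v col z1 z2 where "v \<in> carrier (free_group X)"
    "\<forall>z. outward X v z \<longrightarrow> finite {w \<in> shadow X (v @ [z]). (w \<in> E) \<noteq> col z}"
    "outward X v z1" "outward X v z2" "col z1" "\<not> col z2"
proof -
  \<comment> \<open>\<open>Q v\<close> says that the shadow is monochromatic up to finitely many
    vertices, and \<open>D\<close> collects the finitely many vertices with an adjacent edge along
    which membership in \<open>E\<close> changes.\<close>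
  define Q where "Q v \<longleftrightarrow> (\<exists>b. finite {w \<in> shadow X v. (w \<in> E) \<noteq> b})" for v
  define D where "D = (\<Union>z\<in>X \<times> (UNIV :: bool set). {g
      \<in> carrier (free_group X). (free_reduce (g @ [z]) \<in> E) \<noteq> (g \<in> E)})"
  have "finite D" unfolding D_def using X cob by (intro finite_UN_I) auto
  have memD: "g \<in> D" if "g \<in> carrier (free_group X)" "z \<in> X \<times> UNIV"
      "(free_reduce (g @ [z]) \<in> E) \<noteq> (g \<in> E)" for g z
    unfolding D_def using that by blast
  from \<open>finite D\<close> obtain N where N: "\<forall>g\<in>D. length g < N"
    using finite_nat_set_iff_bounded[of "length ` D"] by auto
  \<comment> \<open>Below a vertex that is deeper than all of \<open>D\<close>, no edge changes
    membership, so the whole shadow has the colour of \<open>v\<close>.\<close>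
  have deep: "Q v" if "v \<in> carrier (free_group X)" "length v \<ge> N" for v
  proof -
    have "v @ t \<in> E \<longleftrightarrow> v \<in> E" if "v @ t \<in> carrier (free_group X)" for t
      using that
    proof (induction t rule: rev_induct)
      case (snoc z t)
      have *: "v @ t \<in> carrier (free_group X)" "z \<in> X \<times> UNIV"
          "free_reduce ((v @ t) @ [z]) = v @ t @ [z]"
        using snoc.prems reduced_append[of "v @ t" "[z]"] free_reduce_reduced[of "v @ t @ [z]"]
        by (auto simp: mem_Times_iff)
      moreover have "v @ t \<notin> D" using N \<open>length v \<ge> N\<close> by force
      ultimately have "v @ t @ [z] \<in> E \<longleftrightarrow> v @ t \<in> E" using memD[OF *(1,2)] by auto
      then show ?case using snoc.IH * by simp
    qed simp
    then have "{w \<in> shadow X v. (w \<in> E) \<noteq> (v \<in> E)} = {}" by (auto simp: shadow_def prefix_def)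
    then show ?thesis unfolding Q_def by (metis finite.emptyI)
  qed
  have "\<not> Q []"
  proof
    assume "Q []"
    then obtain b where "finite {w \<in> carrier (free_group X). (w \<in> E) \<noteq> b}"
      by (auto simp: Q_def shadow_def)
    moreover have "{w \<in> carrier (free_group X). (w \<in> E) \<noteq> b} =
        (if b then carrier (free_group X) - E else carrier (free_group X) \<inter> E)"
      by (cases b) (simp_all add: set_eq_iff del: free_group_simps)
    ultimately show False using inf by (simp split: if_splits)
  qed
  then obtain v where v: "v \<in> carrier (free_group X)" "\<not> Q v"
    and max: "\<And>w. w \<in> carrier (free_group X) \<Longrightarrow> \<not> Q w \<Longrightarrow> length w \<le> length v"
    using ex_has_greatest_nat[of "\<lambda>v. v \<in> carrier (free_group X) \<and> \<not> Q v" "[]" length N] deep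
    by (metis empty_subsetI free_group_simps(1) image_empty list.set(1) not_le reduced_Nil)
  define col where "col z = (SOME b. finite {w \<in> shadow X (v @ [z]). (w \<in> E) \<noteq> b})" for z
  have col: "finite {w \<in> shadow X (v @ [z]). (w \<in> E) \<noteq> col z}" if "outward X v z" for z
  proof -
    have "v @ [z] \<in> carrier (free_group X)" using that v by (auto simp: outward_def)
    then have "Q (v @ [z])" using max[of "v @ [z]"] by auto
    then show ?thesis unfolding Q_def col_def by (rule someI_ex)
  qed
  \<comment> \<open>If all outward directions had the colour \<open>b\<close>, the shadow of
    \<open>v\<close> would be \<open>v\<close> together with finitely many shadows of almost
    constant colour \<open>b\<close>, against \<open>\<not> Q v\<close>.\<close>
  have ex: "\<exists>z. outward X v z \<and> col z \<noteq> b" for b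
  proof (rule ccontr)
    assume neg: "\<nexists>z. outward X v z \<and> col z \<noteq> b"
    have "{w \<in> shadow X v. (w \<in> E) \<noteq> b} \<subseteq>
      {v} \<union> (\<Union>z\<in>{z \<in> X \<times> UNIV. outward X v z}. {w \<in> shadow X (v @ [z]). (w \<in> E) \<noteq> col z})"
    proof
      fix w assume w: "w \<in> {w \<in> shadow X v. (w \<in> E) \<noteq> b}"
      then obtain t where t: "w = v @ t" "reduced w" "fst ` set w \<subseteq> X"
        by (auto simp: shadow_def prefix_def)
      show "w \<in> {v} \<union> (\<Union>z\<in>{z \<in> X \<times> UNIV. outward X v z}. {w \<in> shadow X (v @ [z]). (w \<in> E) \<noteq> col z})"
      proof (cases t)
        case (Cons z t')
        then have "outward X v z"
          using t reduced_append[of "v @ [z]" t'] by (auto simp: outward_def)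
        moreover from this have "z \<in> X \<times> UNIV" by (auto simp: outward_def mem_Times_iff)
        moreover have "w \<in> shadow X (v @ [z])" using t Cons by (auto simp: shadow_def)
        ultimately show ?thesis using neg w by blast
      qed (use t in auto)
    qed
    moreover have "finite \<dots>" using X col by auto
    ultimately have "Q v" unfolding Q_def by (meson finite_subset)
    with v show False by simp
  qed
  obtain z1 z2 where "outward X v z1" "outward X v z2" "col z1" "\<not> col z2"
    using ex[of False] ex[of True] by auto
  from that[OF v(1) _ this] show ?thesis using col by blast
qed

text \<open>The half-line from \<open>v\<close> along the powers of \<open>d\<close> stays at bounded distance from an end of
  a translate of the axis of \<open>f\<close>.\<close>

lemma axis_end_colour:
  fixes X :: "'x set"
  assumes split: "internal_free_product (free_group X) F G"
    and v: "v \<in> carrier (free_group X)" and h: "h \<in> carrier (free_group X)"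
    and d: "cyclically_reduced d" "d \<in> carrier (free_group X)" "outward X v (hd d)"
    and f: "free_reduce (h @ d @ inv_word h) \<in> F"
    and col: "finite {w \<in> shadow X (v @ [hd d]). (w \<in> starts_in_left (free_group X) F G) \<noteq> col}"
  shows "col \<longleftrightarrow> free_reduce (v @ inv_word h) \<in> starts_in_left (free_group X) F G \<union> F"
proof -
  interpret free_splitting "free_group X" F G
    using split group_free_group by (auto simp: free_splitting_def free_splitting_axioms_def)
  let ?f = "free_reduce (h @ d @ inv_word h)" and ?u = "free_reduce (v @ inv_word h)"
  have f_car: "?f \<in> carrier (free_group X)"
    using f factor_carrier[of ?f True] by (simp add: factor_def)
  have u_car: "?u \<in> carrier (free_group X)"
    using v h fst_set_free_reduce[of "v @ inv_word h" X] by (simp add: image_Un del: set_inv_word)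
  \<comment> \<open>Conjugating back by \<open>h\<close> would otherwise give
    \<open>d = []\<close>.\<close>
  have "?f \<noteq> []"
  proof
    assume "?f = []"
    have "d = free_reduce (inv_word h @ (h @ d @ inv_word h) @ h)"
      using free_reduce_cancel_word'[of "[]" h
          "d @ inv_word h @ h"] free_reduce_cancel_word'[of d h "[]"] d(2)
      by (simp add: free_reduce_reduced)
    also have "\<dots> = free_reduce (inv_word h @ ?f @ h)"
      using free_reduce_append_right[of "inv_word h" "?f @ h"]
        free_reduce_append_right[of "inv_word h" "(h @ d @ inv_word h) @ h"]
      by (simp del: free_reduce_append_right)
    also have "\<dots> = []" using \<open>?f = []\<close> free_reduce_inv_word by simp
    finally show False using d(1) by (simp add: cyclically_reduced_def)
  qed
  \<comment> \<open>The conjugating words telescope, so the orbit of \<open>?u\<close> under powers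
    of \<open>?f\<close> differs from the half-line \<open>v @ word_power d k\<close> only by a
    fixed right factor.\<close>
  have ray: "free_reduce (?u @ ?f [^]\<^bsub>free_group X\<^esub> k) =
      free_reduce (v @ word_power d k @ inv_word h)" for k :: nat
  proof -
    have "?f [^]\<^bsub>free_group X\<^esub> k = free_reduce (word_power ?f k)" using free_group_pow f_car
      by blast
    also have "\<dots> = free_reduce (word_power (h @ d @ inv_word h) k)"
    proof (induction k)
      case (Suc k)
      have "free_reduce (word_power ?f (Suc k)) =
          free_reduce ((h @ d @ inv_word h) @ word_power ?f k)"
        by simp
      also have "\<dots> = free_reduce ((h @ d @ inv_word h) @ free_reduce (word_power ?f k))"
        by (simp only: free_reduce_append_right)
      also have "\<dots> = free_reduce (word_power (h @ d @ inv_word h) (Suc k))"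
        unfolding Suc free_reduce_append_right by simp
      finally show ?case .
    qed simp
    finally have "?f [^]\<^bsub>free_group X\<^esub> k = free_reduce (h @ word_power d k @ inv_word h)"
      by (simp add: free_reduce_power_conjugate)
    then have "free_reduce (?u @ ?f [^]\<^bsub>free_group X\<^esub> k) =
        free_reduce ((v @ inv_word h) @ h @ word_power d k @ inv_word h)"
      by (simp only: free_reduce_append_left free_reduce_append_right)
    then show ?thesis using free_reduce_cancel_word'[of v h] by simp
  qed
  have red: "reduced (v @ word_power d k)" for k
    using v d reduced_word_power[OF d(1), of k] 
    by (cases "k = 0") (auto simp: outward_def reduced_append cyclically_reduced_def hd_word_power)
  have ray': "free_reduce (free_reduce (?u @ ?f [^]\<^bsub>free_group X\<^esub> k) @ h) = v @ word_power d k"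
      for k :: nat
  proof -
    have "free_reduce (free_reduce (?u @ ?f [^]\<^bsub>free_group X\<^esub> k) @ h) =
        free_reduce ((v @ word_power d k) @ inv_word h @ h @ [])"
      unfolding ray by simp
    then show ?thesis using red free_reduce_cancel_word'[of "v @ word_power d k" h "[]"]
      by (simp add: free_reduce_reduced)
  qed
  have "finite {k::nat. (?u \<otimes>\<^bsub>free_group X\<^esub> ?f [^]\<^bsub>free_group X\<^esub> k \<otimes>\<^bsub>free_group X\<^esub> h \<in> E) \<noteq>
      (?u \<in> E \<union> F)}"
    using left_power_eventually[OF f inj_free_group_pow[OF f_car \<open>?f \<noteq> []\<close>] u_car h] .
  then have 1: "finite {k::nat. (v @ word_power d k \<in> E) \<noteq> (?u \<in> E \<union> F)}"
    by (simp only: free_group_simps ray')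
  have inj: "inj (\<lambda>k. v @ word_power d k)"
    using d(1) by (auto simp: inj_def cyclically_reduced_def dest!: arg_cong[of _ _ length] simp:
        length_concat sum_list_replicate)
  have sh: "v @ word_power d (Suc k) \<in> shadow X (v @ [hd d])" for k
  proof -
    have "d = hd d # tl d" using d(1) by (simp add: cyclically_reduced_def)
    then have "v @ word_power d (Suc k) = (v @ [hd d]) @ tl d @ word_power d k"
      by (metis append_Cons append_Nil append_assoc concat.simps(2) replicate_Suc)
    moreover have "fst ` set (v @ word_power d (Suc k)) \<subseteq> X" using v d(2)
      by (fastforce simp: image_subset_iff)
    ultimately show ?thesis using red[of "Suc k"] by (simp add: shadow_def del: replicate.simps)
  qed
  have "finite ((\<lambda>k. v @ word_power d k) -` {w \<in> shadow X (v @ [hd d]). (w \<in> E) \<noteq> col})"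
    by (rule finite_vimageI[OF col inj])
  \<comment> \<open>The value \<open>k = 0\<close> is excluded because \<open>v\<close> is not in
    the shadow. Any \<open>k\<close> outside this finite set compares the two colours.\<close>
  with 1 have "finite ({0} \<union> (\<lambda>k. v @ word_power d k) -` {w \<in> shadow X (v @ [hd d]). (w \<in> E) \<noteq>
      col} \<union>
      {k. (v @ word_power d k \<in> E) \<noteq> (?u \<in> E \<union> F)})" (is "finite ?S") by (intro finite_UnI) simp_all
  from ex_new_if_finite[OF infinite_UNIV_nat this] obtain k where k: "k \<notin> ?S" by (rule exE)
  then have "k \<noteq> 0" by simp
  then have "v @ word_power d k \<in> shadow X (v @ [hd d])" using sh[of "k - 1"]
    by (simp del: replicate.simps)
  with k show ?thesis by simp argo
qed

section \<open>Whitehead's argument for separable elements\<close>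

text \<open>A translate of the axis passes through \<open>v\<close>, leaving it along
  \<open>z\<close> in one direction and along \<open>inv_letter y\<close> in the other. Both
  half-lines are governed by the same element \<open>free_reduce (v @ inv_word h')\<close>, so their
  colours agree.\<close>

lemma consecutive_letters_same_colour:
  fixes X :: "'x set"
  assumes split: "internal_free_product (free_group X) F G"
    and v: "v \<in> carrier (free_group X)" and h: "h \<in> carrier (free_group X)"
    and c: "cyclically_reduced c" "c \<in> carrier (free_group X)" "sublist [y, z] c"
    and f: "free_reduce (h @ c @ inv_word h) \<in> F"
    and col: "\<And>z. outward X v z \<Longrightarrow>
      finite {w \<in> shadow X (v @ [z]). (w \<in> starts_in_left (free_group X) F G) \<noteq> col z}"
    and out: "outward X v (inv_letter y)" "outward X v z"
  shows "col (inv_letter y) = col z"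
proof -
  obtain c1 c2 where c12: "c = c1 @ [y, z] @ c2" using c(3) by (auto simp: sublist_def)
  \<comment> \<open>The rotation \<open>d\<close> starts with \<open>z\<close> and its inverse
    starts with \<open>inv_letter y\<close>. The word \<open>k\<close> absorbs the rotation:
    conjugating \<open>d\<close> by \<open>k\<close> gives the same element as conjugating
    \<open>c\<close> by \<open>h\<close>.\<close>
  define d where "d = z # c2 @ c1 @ [y]"
  define k where "k = h @ c1 @ [y]"
  define h' where "h' = free_reduce k"
  have "cyclically_reduced d"
    using cyclically_reduced_rotate[of "c1 @ [y]" "z # c2"] c(1) by (simp add: c12 d_def)
  have "reduced d" using \<open>cyclically_reduced d\<close> by (simp add: cyclically_reduced_def reduced_append)
  moreover have "fst ` set d \<subseteq> X" using c(2) by (auto simp: c12 d_def)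
  ultimately have d: "d \<in> carrier (free_group X)" "inv_word d \<in> carrier (free_group X)"
    by (simp_all only: free_group_simps fst_set_inv_word reduced_inv_word)
  have h': "h' \<in> carrier (free_group X)"
    using h c(2) fst_set_free_reduce[of k X] by (auto simp: h'_def k_def c12)
  have inv_h': "inv_word h' = free_reduce (inv_word k)"
  proof -
    have "inv_word h' = free_reduce (inv_word h')" by (simp add: free_reduce_reduced h'_def)
    also have "\<dots> = free_reduce (inv_word h' @ k @ inv_word k @ [])"
      using free_reduce_cancel_word[of "inv_word h'" k "[]"] by simp
    also have "\<dots> = free_reduce (free_reduce (inv_word h' @ h') @ inv_word k)"
      using free_reduce_append_right[of "inv_word h'" "k"] by (simp add: h'_def)
    also have "\<dots> = free_reduce (inv_word k)" unfolding free_reduce_inv_word by simp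
    finally show ?thesis .
  qed
  have conj: "free_reduce (h' @ w @ inv_word h') = free_reduce (k @ w @ inv_word k)" for w
    using free_reduce_append_right[of "k @ w" "inv_word k"]
    by (simp add: h'_def[symmetric] inv_h') (simp add: h'_def)
  have "k @ d @ inv_word k = (h @ c) @ (c1 @ [y]) @ inv_word (c1 @ [y]) @ inv_word h"
    by (simp add: k_def d_def c12)
  then have fd: "free_reduce (h' @ d @ inv_word h') \<in> F"
    unfolding conj using f free_reduce_cancel_word[of "h @ c" "c1 @ [y]" "inv_word h"] by simp
  interpret free_splitting "free_group X" F G
    using split group_free_group by (auto simp: free_splitting_def free_splitting_axioms_def)
  have F: "subgroup F (free_group X)" using subgroup_factor[of True] by (simp add: factor_def)
  \<comment> \<open>The opposite half-line needs the inverse element, which lies in the subgroup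
    \<open>F\<close> as well.\<close>
  have "free_reduce (h' @ inv_word d @ inv_word h') \<in> F"
  proof -
    let ?a = "free_reduce (h' @ d @ inv_word h')"
        and ?b = "free_reduce (h' @ inv_word d @ inv_word h')"
    have "free_reduce (?b @ ?a) = free_reduce ((h' @ inv_word d) @ inv_word h' @ h' @ (d @
        inv_word h'))"
      unfolding free_reduce_append_left free_reduce_append_right by simp
    also have "\<dots> = free_reduce (h' @ inv_word d @ d @ inv_word h')"
      using free_reduce_cancel_word'[of "h' @ inv_word d" h' "d @ inv_word h'"] by simp
    also have "\<dots> = []"
      using free_reduce_cancel_word'[of h' d "inv_word h'"] free_reduce_cancel_word[of "[]" h' "[]"]
      by (simp add: free_reduce_def)
    finally have "?b \<otimes>\<^bsub>free_group X\<^esub> ?a = \<one>\<^bsub>free_group X\<^esub>" by simp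
    moreover have "?a \<in> carrier (free_group X)" using subgroup.mem_carrier[OF F fd] .
    moreover have "?b \<in> carrier (free_group X)"
      using h' d(1) fst_set_free_reduce[of "h' @ inv_word d @ inv_word h'" X]
      by (simp add: image_Un del: set_inv_word)
    ultimately have "?b = inv\<^bsub>free_group X\<^esub> ?a" by (metis inv_equality)
    then show ?thesis using subgroup.m_inv_closed[OF F fd] by simp
  qed
  moreover have "hd d = z" "hd (inv_word d) = inv_letter y" by (simp_all add: d_def)
  ultimately show ?thesis
    using axis_end_colour[OF split v h' \<open>cyclically_reduced d\<close> d(1) _ fd, of "col z"]
      axis_end_colour[OF split v h' cyclically_reduced_inv_word[OF \<open>cyclically_reduced d\<close>] d(2),
          of "col (inv_letter y)"]
      out col by simp
qed

text \<open>The words whose Whitehead graph contains the Hamiltonian cycle of \<open>x\<^sub>1\<^sup>2 \<dots> x\<^sub>n\<^sup>2\<close>.\<close>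

definition hamiltonian :: "nat \<Rightarrow> nat word \<Rightarrow> bool" where
  "hamiltonian n c \<longleftrightarrow>
     (\<forall>i\<in>{1..n}. sublist [(i, True), (i, True)] c) \<and>
     (\<forall>i\<in>{1..<n}. sublist [(i, True), (Suc i, True)] c) \<and> sublist [(n, True), (1, True)] c"

text \<open>The letters in their order along that cycle, repeated with period \<open>2 n\<close>.\<close>

definition cycle_letter :: "nat \<Rightarrow> nat \<Rightarrow> nat \<times> bool" where
  "cycle_letter n j = (Suc ((j mod (2 * n)) div 2), even j)"

text \<open>A subword \<open>[y, z]\<close> joins \<open>inv_letter y\<close> to \<open>z\<close>.
  Squares of generators join a generator to its inverse, and the pairs of successive generators join
  the inverse of one to the next, with wrap-around from \<open>n\<close> to \<open>1\<close>. The
  two alternatives are the two orientations of such an edge.\<close>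

lemma cycle_letter_step:
  assumes "n \<ge> 1" "hamiltonian n c"
  obtains y where "inv_letter y = cycle_letter n j" "sublist [y, cycle_letter n (Suc j)] c"
    | y where "inv_letter y = cycle_letter n (Suc j)" "sublist [y, cycle_letter n j] c"
proof -
  define r where "r = j mod (2 * n)"
  have r: "r < 2 * n" "even r \<longleftrightarrow> even j" using assms(1) by (auto simp: r_def dvd_mod_iff)
  have L: "cycle_letter n j = (Suc (r div 2), even r)"
    by (simp add: cycle_letter_def r_def[symmetric] r)
  show ?thesis
  proof (cases "even r")
    case True
    then obtain i where i: "r = 2 * i" by auto
    then have "Suc j mod (2 * n) = Suc r" using r by (simp add: r_def mod_Suc)
    then have "cycle_letter n (Suc j) = (Suc i, False)" "cycle_letter n j = (Suc i, True)"
      using i r True L by (auto simp: cycle_letter_def)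
    moreover have "Suc i \<in> {1..n}" using i r by auto
    ultimately show ?thesis using that(2)[of "(Suc i, True)"] assms(2)
      by (simp add: inv_letter_def hamiltonian_def)
  next
    case False
    then obtain i where i: "r = Suc (2 * i)" by (auto elim: oddE)
    then have Lj: "cycle_letter n j = (Suc i, False)" using L by simp
    show ?thesis
    proof (cases "Suc r = 2 * n")
      case True
      then have "Suc j mod (2 * n) = 0" by (simp add: r_def mod_Suc)
      have "n = Suc i" using True i by simp
      from \<open>Suc j mod (2 * n) = 0\<close> have "cycle_letter n (Suc j) = (1, True)" using False r
        by (simp add: cycle_letter_def)
      then show ?thesis using that(1)[of "(Suc i, True)"] assms(2) Lj \<open>n = Suc i\<close>
        by (simp add: inv_letter_def hamiltonian_def)
    next
      case nf: False
      then have "Suc j mod (2 * n) = Suc r" by (simp add: r_def mod_Suc)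
      then have "cycle_letter n (Suc j) = (Suc (Suc i), True)" using False r i
        by (simp add: cycle_letter_def)
      moreover have "Suc i \<in> {1..<n}" using nf r i by auto
      ultimately show ?thesis using that(1)[of "(Suc i, True)"] assms(2) Lj
        by (simp add: inv_letter_def hamiltonian_def)
    qed
  qed
qed

lemma cycle_letter_surj:
  assumes "fst z \<in> {1..n}"
  obtains j where "j < 2 * n" "z = cycle_letter n j"
proof -
  obtain i b where z: "z = (i, b)" "i \<in> {1..n}" using assms by (cases z) auto
  show ?thesis
  proof (cases b)
    case True
    then show ?thesis using that[of "2 * (i - 1)"] z by (auto simp: cycle_letter_def)
  next
    case False
    then show ?thesis using that[of "Suc (2 * (i - 1))"] z by (auto simp: cycle_letter_def)
  qed
qed

lemma cycle_letter_inj: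
  assumes "cycle_letter n i = cycle_letter n j"
  shows "i mod (2 * n) = j mod (2 * n)"
proof -
  have "(i mod (2 * n)) div 2 = (j mod (2 * n)) div 2" "even (i mod (2 * n)) = even (j mod (2 * n))"
    using assms by (auto simp: cycle_letter_def dvd_mod_iff)
  moreover have "a = b" if "a div 2 = b div 2" "even a = even b" for a b :: nat
    using that by presburger
  ultimately show ?thesis by blast
qed

lemma cycle_letter_mod: "cycle_letter n (j mod (2 * n)) = cycle_letter n j"
  by (simp add: cycle_letter_def dvd_mod_iff)

text \<open>At a branching vertex both colours occur, but a cycle with at most one vertex removed is
  connected, and its edges preserve colours.\<close>

lemma free_factor_not_hamiltonian:
  assumes n: "n \<ge> 1" and split: "internal_free_product (free_group {1..n}) F G"
    and nontriv: "F \<noteq> {[]}" "G \<noteq> {[]}"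
    and h: "h \<in> carrier (free_group {1..n})"
    and c: "cyclically_reduced c" "c \<in> carrier (free_group {1..n})"
    and f: "free_reduce (h @ c @ inv_word h) \<in> F"
  shows "\<not> hamiltonian n c"
proof
  assume ham: "hamiltonian n c"
  let ?X = "{1..n}"
  interpret free_splitting "free_group ?X" F G
    using split group_free_group by (auto simp: free_splitting_def free_splitting_axioms_def)
  have cob: "finite {g \<in> carrier (free_group ?X). (free_reduce (g @ [z]) \<in> E) \<noteq> (g \<in> E)}"
      if "fst z \<in> ?X" for z
    using finite_left_coboundary[of "[z]"] that by (simp add: reduced_def)
  \<comment> \<open>A nontrivial element of a factor has infinitely many powers in that factor, so
    both sides of the splitting are infinite.\<close>
  have inf: "infinite {g \<in> factor t. g \<noteq> []}" for t
  proof -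
    have sub: "subgroup (factor t) (free_group ?X)" by (rule subgroup_factor)
    have "factor t \<noteq> {[]}" "[] \<in> factor t" using nontriv subgroup.one_closed[OF sub]
      by (auto simp: factor_def)
    then obtain a where a: "a \<in> factor t" "a \<noteq> []" by auto
    have inj: "inj (\<lambda>k::nat. a [^]\<^bsub>free_group ?X\<^esub> k)"
      using inj_free_group_pow[OF subgroup.mem_carrier[OF sub a(1)] a(2)] .
    have "a [^]\<^bsub>free_group ?X\<^esub> k \<in> factor t" for k :: nat
      using a(1) subgroup.one_closed[OF sub] subgroup.m_closed[OF sub]
      by (induction k) (simp_all del: free_group_simps)
    then have "range (\<lambda>k::nat. a [^]\<^bsub>free_group ?X\<^esub> k) \<subseteq> insert [] {g \<in> factor t. g \<noteq> []}" by auto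
    then show ?thesis using range_inj_infinite[OF inj] finite_subset by auto
  qed
  have side: "g \<in> carrier (free_group ?X) \<and> (g \<in> E \<longleftrightarrow> t)" if "g \<in> factor t" "g \<noteq> []" for g t
    using factor_in_left_iff[of g t] factor_carrier[of g t] that by simp
  have "{g \<in> factor True. g \<noteq> []} \<subseteq> carrier (free_group ?X) \<inter> E"
  proof
    fix g assume "g \<in> {g \<in> factor True. g \<noteq> []}"
    then show "g \<in> carrier (free_group ?X) \<inter> E" using side[of g True] by simp
  qed
  then have inf1: "infinite (carrier (free_group ?X) \<inter> E)" by (rule infinite_super) (rule inf)
  have "{g \<in> factor False. g \<noteq> []} \<subseteq> carrier (free_group ?X) - E"
  proof
    fix g assume "g \<in> {g \<in> factor False. g \<noteq> []}"
    then show "g \<in> carrier (free_group ?X) - E" using side[of g False] by simp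
  qed
  then have inf2: "infinite (carrier (free_group ?X) - E)" by (rule infinite_super) (rule inf)
  obtain v col z1 z2 where v: "v \<in> carrier (free_group ?X)"
    and col: "\<forall>z. outward ?X v z \<longrightarrow> finite {w \<in> shadow ?X (v @ [z]). (w \<in> E) \<noteq> col z}"
    and z12: "outward ?X v z1" "outward ?X v z2" "col z1" "\<not> col z2"
    by (rule branching_vertex[OF finite_atLeastAtMost cob inf1 inf2])
  have cons: "col (inv_letter y) = col z"
    if "sublist [y, z] c" "outward ?X v (inv_letter y)" "outward ?X v z" for y z
    by (rule consecutive_letters_same_colour[OF split v h c that(1) f _ that(2,3)])
      (use col in blast)
  have step: "col (cycle_letter n (Suc j)) = col (cycle_letter n j)"
    if "outward ?X v (cycle_letter n j)" "outward ?X v (cycle_letter n (Suc j))" for j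
    by (rule cycle_letter_step[OF n ham, of j]) (metis cons that)+
  \<comment> \<open>\<open>j0\<close> is the position on the cycle of the direction towards the
    root; at the root itself it is arbitrary.\<close>
  obtain j0 where j0: "\<And>z. fst z \<in> ?X \<Longrightarrow> z \<noteq> cycle_letter n j0 \<Longrightarrow> outward ?X v z"
  proof (cases "v = []")
    case True
    then show ?thesis using that by (auto simp: outward_def reduced_def)
  next
    case False
    then have "fst (inv_letter (last v)) \<in> ?X" using v last_in_set[of v]
      by (auto simp: image_subset_iff)
    then obtain j0 where "inv_letter (last v) = cycle_letter n j0" using cycle_letter_surj by metis
    then show ?thesis using that[of j0] v by (auto simp: outward_def reduced_snoc)
  qed
  have fst_letter: "fst (cycle_letter n j) \<in> ?X" for j
  proof -
    have "j mod (2 * n) < 2 * n" using n by simp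
    then have "Suc ((j mod (2 * n)) div 2) \<le> n" by linarith
    then show ?thesis by (simp add: cycle_letter_def)
  qed
  have out: "outward ?X v (cycle_letter n (j0 + j))" if "1 \<le> j" "j < 2 * n" for j
  proof -
    have "(j0 + j) mod (2 * n) \<noteq> j0 mod (2 * n)"
    proof
      assume "(j0 + j) mod (2 * n) = j0 mod (2 * n)"
      then have "(2 * n) dvd j" using mod_eq_dvd_iff_nat[of j0 "j0 + j" "2 * n"] by simp
      then show False using that by (auto dest: dvd_imp_le)
    qed
    then show ?thesis using j0 fst_letter cycle_letter_inj by blast
  qed
  have chain: "col (cycle_letter n (j0 + Suc i)) = col (cycle_letter n (j0 + 1))"
      if "Suc i < 2 * n" for i
    using that
  proof (induction i)
    case (Suc i)
    then show ?case using step[of "j0 + Suc i"] out[of "Suc i"] out[of "Suc (Suc i)"] by simp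
  qed simp
  have all: "col z = col (cycle_letter n (j0 + 1))" if z: "outward ?X v z" for z
  proof -
    obtain i where i: "i < 2 * n" "z = cycle_letter n i" using cycle_letter_surj z
      by (metis outward_def)
    \<comment> \<open>The position of \<open>z\<close> counted from \<open>j0\<close>. The value
      \<open>0\<close> occurs only for \<open>v = []\<close>, and then one more step of the cycle
      reaches the chain.\<close>
    define j where "j = (i + (2 * n - j0 mod (2 * n))) mod (2 * n)"
    have jl: "j < 2 * n" using n by (simp add: j_def)
    have le: "j0 mod (2 * n) < 2 * n" using n by simp
    have "(j0 + j) mod (2 * n) = (j0 mod (2 * n) + (i + (2 * n - j0 mod (2 * n)))) mod (2 * n)"
      by (simp add: j_def mod_add_left_eq mod_add_right_eq)
    also have "j0 mod (2 * n) + (i + (2 * n - j0 mod (2 * n))) = i + 2 * n" using le by simp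
    finally have "(j0 + j) mod (2 * n) = i" using i by simp
    then have zj: "z = cycle_letter n (j0 + j)" using i cycle_letter_mod[of n "j0 + j"] by simp
    show ?thesis
    proof (cases j)
      case 0
      then show ?thesis using step[of j0] out[of 1] z zj n by simp
    next
      case (Suc i)
      then show ?thesis using chain[of i] jl zj by simp
    qed
  qed
  show False using all z12 by metis
qed

lemma hamiltonian_sublist: "hamiltonian n p \<Longrightarrow> sublist p c \<Longrightarrow> hamiltonian n c"
  unfolding hamiltonian_def using sublist_order.order_trans by blast

lemma sublist_inv_word: "sublist p w \<Longrightarrow> sublist (inv_word p) (inv_word w)"
  unfolding sublist_def by (metis append_assoc inv_word_simps(3))

text \<open>Neither \<open>p\<close> nor its inverse occurs in the cyclically reduced core
  \<open>c\<close>, so only the two junctions with \<open>g\<close> and its inverse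
  contribute.\<close>

lemma brooks_separable:
  assumes n: "n \<ge> 1" and p: "hamiltonian n p"
    and a: "a \<in> separable_elements (free_group {1..n})"
  shows "\<bar>brooks p a\<bar> \<le> 2 * int (length p)"
proof (cases "a = []")
  case False
  obtain F G where F: "a \<in> F" "F \<noteq> {[]}" "G \<noteq> {[]}"
      and split: "internal_free_product (free_group {1..n}) F G"
    using a by (auto simp: separable_elements_def proper_free_factor_def
        nontrivial_proper_subgroup_def)
  have sub: "subgroup F (free_group {1..n})" using split by (simp add: internal_free_product_def)
  have a_car: "a \<in> carrier (free_group {1..n})" using subgroup.mem_carrier[OF sub F(1)] .
  obtain g c where gc: "a = g @ c @ inv_word g" "cyclically_reduced c"
    using cyclic_decomposition[of a] a_car False by auto
  have red: "reduced a" "reduced g" "reduced c" using a_car gc by (auto simp: reduced_append)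
  have car: "g \<in> carrier (free_group {1..n})" "c \<in> carrier (free_group {1..n})"
    using a_car red unfolding free_group_simps gc(1) set_append image_Un by auto
  \<comment> \<open>Occurrences of the inverse of \<open>p\<close> in \<open>c\<close> are
    occurrences of \<open>p\<close> in the inverse of \<open>c\<close>, so the argument is applied
    to the inverse of \<open>a\<close> too.\<close>
  have "inv_word a \<in> F"
    using subgroup.m_inv_closed[OF sub F(1)] inv_free_group[OF a_car] by simp
  moreover have "reduced (g @ inv_word c @ inv_word g)" using reduced_inv_word[of a] red(1) gc(1)
    by simp
  ultimately have "\<not> hamiltonian n (inv_word c)"
    using free_factor_not_hamiltonian[OF n split F(2,3) car(1) cyclically_reduced_inv_word[OF
        gc(2)]] car red
    by (simp add: gc(1) free_reduce_reduced image_image)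
  then have 1: "\<not> sublist (inv_word p) c"
    using hamiltonian_sublist[OF p] sublist_inv_word[of "inv_word p" c] by auto
  have "\<not> hamiltonian n c"
    using free_factor_not_hamiltonian[OF n split F(2,3) car(1) gc(2) car(2)] F(1) red gc(1)
    by (simp add: free_reduce_reduced)
  then have 2: "\<not> sublist p c" using hamiltonian_sublist[OF p] by auto
  have "brooks p c = 0" using 1 2 by (simp add: brooks_def occurrences_eq_0)
  moreover have "p \<noteq> []" using p by (auto simp: hamiltonian_def)
  ultimately show ?thesis
    using brooks_append[of p g "c @ inv_word g"] brooks_append[of p c
        "inv_word g"] brooks_inv_word[of p g]
    unfolding gc(1) by linarith
qed (simp add: brooks_def)

section \<open>Powers of generators are separable\<close>

lemma seq_product_free_group:
  assumes "\<forall>a\<in>set s. snd a \<in> carrier (free_group X)"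
  shows "seq_product (free_group X) s = free_reduce (concat (map snd s))"
  using assms
proof (induction s)
  case (Cons a s)
  then show ?case by (simp add: seq_product_def)
qed (simp add: seq_product_def free_reduce_def)

text \<open>Adjacent syllables use disjoint alphabets, so nothing cancels between them, and the
  first letter reveals the first tag.\<close>

lemma free_product_seqs_disjoint_generators:
  fixes A B :: "'x set"
  assumes AB: "A \<inter> B = {}"
    and s: "s \<in> free_product_seqs (free_group (A \<union> B)) (carrier (free_group A)) (carrier
        (free_group B))"
  shows "reduced (concat (map snd s))"
    and "s \<noteq> [] \<Longrightarrow> concat (map snd s) \<noteq> [] \<and> (fst (hd (concat (map snd s))) \<in> A \<longleftrightarrow> fst (hd s))"
    and "fst ` set (concat (map snd s)) \<subseteq> A \<union> B"
    and "seq_product (free_group (A \<union> B)) s = concat (map snd s)"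
proof -
  have *: "reduced (concat (map snd s)) \<and> fst ` set (concat (map snd s)) \<subseteq> A \<union> B \<and>
      (\<forall>a\<in>set s. snd a \<in> carrier (free_group (A \<union> B))) \<and>
      (s \<noteq> [] \<longrightarrow> concat (map snd s) \<noteq> [] \<and> (fst (hd (concat (map snd s))) \<in> A \<longleftrightarrow> fst (hd s)))"
    using s
  proof (induction s)
    case (Cons a s)
    obtain t g where a: "a = (t, g)" by (cases a)
    have g: "g \<noteq> []" "reduced g" "fst ` set g \<subseteq> (if t then A else B)"
        and s: "s \<noteq> [] \<Longrightarrow> fst (hd s) \<noteq> t"
      and "s \<in> free_product_seqs (free_group (A \<union> B)) (carrier (free_group A)) (carrier
          (free_group B))"
      using Cons.prems by (auto simp: free_product_seqs_def a successively_Cons split: if_splits)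
    then have IH: "reduced (concat (map snd s))" "fst ` set (concat (map snd s)) \<subseteq> A \<union> B"
      "\<forall>a\<in>set s. snd a \<in> carrier (free_group (A \<union> B))"
      "s \<noteq> [] \<Longrightarrow> concat (map snd s) \<noteq> [] \<and> (fst (hd (concat (map snd s))) \<in> A \<longleftrightarrow> fst (hd s))"
      using Cons.IH by blast+
    have hd: "fst (hd g) \<in> (if t then A else B)" and last: "fst (last g) \<in> (if t then A else B)"
      using g hd_in_set[of g] last_in_set[of g] by (auto simp: image_subset_iff)
    have 1: "fst (hd (g @ concat (map snd s))) \<in> A \<longleftrightarrow> t" using hd g(1) AB by (auto split: if_splits)
    have 2: "fst ` set (g @ concat (map snd s)) \<subseteq> A \<union> B"
    proof -
      have "fst ` set g \<subseteq> A \<union> B" using g(3) by (auto split: if_splits)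
      with IH(2) show ?thesis by (simp add: image_Un)
    qed
    have "hd (concat (map snd s)) \<noteq> inv_letter (last g)" if "concat (map snd s) \<noteq> []"
    proof
      assume e: "hd (concat (map snd s)) = inv_letter (last g)"
      have "s \<noteq> []" using that by auto
      then have "fst (hd (concat (map snd s))) \<in> A \<longleftrightarrow> \<not> t" using IH(4) s by blast
      then show False using last AB unfolding e fst_inv_letter by (auto split: if_splits)
    qed
    then have "reduced (g @ concat (map snd s))" using g(2) IH(1) by (simp add: reduced_append)
    moreover have "fst ` set g \<subseteq> A \<union> B" using g(3) by (auto split: if_splits)
    ultimately show ?case using 1 2 g(1,2) IH(3) by (simp add: a)
  qed simp
  then show "reduced (concat (map snd s))" "fst ` set (concat (map snd s)) \<subseteq> A \<union> B"
    "s \<noteq> [] \<Longrightarrow> concat (map snd s) \<noteq> [] \<and> (fst (hd (concat (map snd s))) \<in> A \<longleftrightarrow> fst (hd s))" by blast+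
  show "seq_product (free_group (A \<union> B)) s = concat (map snd s)"
    using seq_product_free_group[of s "A \<union> B"] * free_reduce_reduced by metis
qed

lemma subgroup_free_group_mono:
  assumes "A \<subseteq> X" shows "subgroup (carrier (free_group A)) (free_group X)"
proof (rule group.subgroupI[OF group_free_group])
  show "carrier (free_group A) \<subseteq> carrier (free_group X)" using assms
    by (simp add: subset_iff[of "carrier _"] del: image_subset_iff) (meson order_trans)
  show "carrier (free_group A) \<noteq> {}" using reduced_Nil[where 'a='a]
    by (metis empty_iff empty_subsetI free_group_simps(1) image_empty list.set(1))
next
  fix a assume a: "a \<in> carrier (free_group A)"
  then have "a \<in> carrier (free_group X)" using assms order_trans[of "fst ` set a" A X] by simp
  then show "inv\<^bsub>free_group X\<^esub> a \<in> carrier (free_group A)"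
    using a by (simp add: inv_free_group image_image)
next
  fix a b assume "a \<in> carrier (free_group A)" "b \<in> carrier (free_group A)"
  then show "a \<otimes>\<^bsub>free_group X\<^esub> b \<in> carrier (free_group A)"
    using fst_set_free_reduce[of "a @ b" A] by (simp add: image_Un)
qed

text \<open>Normal forms correspond to the cutting of a reduced word into maximal blocks over
  \<open>A\<close> and over \<open>B\<close>.\<close>

lemma free_group_disjoint_generators:
  fixes A B :: "'x set"
  assumes AB: "A \<inter> B = {}"
  shows "internal_free_product (free_group (A \<union> B)) (carrier (free_group A)) (carrier (free_group
      B))"
proof -
  let ?S = "free_product_seqs (free_group (A \<union> B)) (carrier (free_group A)) (carrier (free_group
      B))"
  note props = free_product_seqs_disjoint_generators[OF AB]
  have ConsD: "(t, g) # s \<in> ?S \<longleftrightarrow> g \<noteq> [] \<and> reduced g \<and> fst ` set g \<subseteq> (if t then A else B) \<and> s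
      \<in> ?S \<and> (s \<noteq> [] \<longrightarrow> fst (hd s) \<noteq> t)"
    for t g s by (auto simp: free_product_seqs_def successively_Cons)
  \<comment> \<open>The first syllable can be read off from the concatenated word, which gives
    injectivity by induction.\<close>
  have block: "takeWhile (\<lambda>z. fst z \<in> A \<longleftrightarrow> t) (g @ concat (map snd s)) = g"
    if "(t, g) # s \<in> ?S" for t g s
  proof -
    have "\<forall>z\<in>set g. fst z \<in> A \<longleftrightarrow> t" using that AB
      by (auto simp: ConsD image_subset_iff split: if_splits)
    moreover have "takeWhile (\<lambda>z. fst z \<in> A \<longleftrightarrow> t) (concat (map snd s)) = []"
    proof (cases "s = []")
      case False
      have "s \<in> ?S" "fst (hd s) \<noteq> t" using that False by (simp_all add: ConsD)
      then have "concat (map snd s) \<noteq> []" "(fst (hd (concat (map snd s))) \<in> A) \<noteq> t"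
        using props(2)[of s] False by auto
      then show ?thesis by (cases "concat (map snd s)") auto
    qed simp
    ultimately show ?thesis by (simp add: takeWhile_append2)
  qed
  have "s = s'" if "s \<in> ?S" "s' \<in> ?S" "concat (map snd s) = concat (map snd s')" for s s'
    using that
  proof (induction s arbitrary: s')
    case Nil
    then show ?case using props(2)[of s'] by auto
  next
    case (Cons a s)
    obtain t g where a: "a = (t, g)" by (cases a)
    have "s' \<noteq> []" using Cons.prems props(2)[of "a # s"] by auto
    then obtain t' g' r where s': "s' = (t', g') # r" by (cases s') auto
    have "t = t'" using props(2)[OF Cons.prems(1)] props(2)[OF Cons.prems(2)] Cons.prems(3)
      by (simp add: a s')
    have eq: "g @ concat (map snd s) = g' @ concat (map snd r)" using Cons.prems(3)
      by (simp add: a s')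
    then have "g = g'" using block[of t g s] block[of t g' r] Cons.prems(1,2) \<open>t = t'\<close>
      by (simp add: a s')
    with eq have "concat (map snd s) = concat (map snd r)" by simp
    then have "s = r" using Cons.IH[of r] Cons.prems(1,2) by (simp add: a s' ConsD)
    then show ?case using \<open>t = t'\<close> \<open>g = g'\<close> by (simp add: a s')
  qed
  then have inj: "inj_on (seq_product (free_group (A \<union> B))) ?S"
    using props(4) by (intro inj_onI) metis
  have surj: "\<exists>s\<in>?S. concat (map snd s) = w" if "reduced w" "fst ` set w \<subseteq> A \<union> B" for w
    using that
  proof (induction w)
    case Nil
    have "[] \<in> ?S" by (simp add: free_product_seqs_def)
    then show ?case by force
  next
    case (Cons x w)
    define t where "t \<longleftrightarrow> fst x \<in> A"
    have x: "fst x \<in> (if t then A else B)" using Cons.prems by (auto simp: t_def)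
    obtain s where s: "s \<in> ?S" "concat (map snd s) = w"
      using Cons by (auto simp: reduced_Cons)
    show ?case
    \<comment> \<open>The new letter either extends the first syllable or opens a new one.\<close>
    proof (cases "s \<noteq> [] \<and> fst (hd s) = t")
      case True
      then obtain g r where sr: "s = (t, g) # r" by (cases s) auto
      have g: "g \<noteq> []" "reduced g" using s(1) by (simp_all add: sr ConsD)
      have "hd g = hd w" using s(2) g(1) by (auto simp: sr)
      then have "reduced (x # g)" using Cons.prems(1) g s(2) by (auto simp: reduced_Cons sr)
      then have "(t, x # g) # r \<in> ?S" using s(1) x by (auto simp: sr ConsD)
      moreover have "concat (map snd ((t, x # g) # r)) = x # w" using s(2) by (simp add: sr)
      ultimately show ?thesis by blast
    next
      case False
      then have "(t, [x]) # s \<in> ?S" using s(1) x by (auto simp: ConsD reduced_def)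
      moreover have "concat (map snd ((t, [x]) # s)) = x # w" using s(2) by simp
      ultimately show ?thesis by blast
    qed
  qed
  have "seq_product (free_group (A \<union> B)) ` ?S = carrier (free_group (A \<union> B))"
  proof
    show "seq_product (free_group (A \<union> B)) ` ?S \<subseteq> carrier (free_group (A \<union> B))"
      using props by auto
    show "carrier (free_group (A \<union> B)) \<subseteq> seq_product (free_group (A \<union> B)) ` ?S"
    proof
      fix w assume "w \<in> carrier (free_group (A \<union> B))"
      then obtain s where "s \<in> ?S" "concat (map snd s) = w" using surj[of w] by auto
      then show "w \<in> seq_product (free_group (A \<union> B)) ` ?S" using props(4)[of s]
        by (metis image_eqI)
    qed
  qed
  then show ?thesis
    using inj subgroup_free_group_mono[of A "A \<union> B"] subgroup_free_group_mono[of B "A \<union> B"]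
    by (simp add: internal_free_product_def bij_betw_def)
qed

lemma generator_power_separable:
  fixes n i :: nat
  assumes "n \<ge> 2" "i \<in> {1..n}"
  shows "replicate k (i, True) \<in> separable_elements (free_group {1..n})"
proof -
  \<comment> \<open>A second generator, available since \<open>n \<ge> 2\<close>: it shows that
    \<open>?F\<close> is proper and that \<open>?G\<close> is nontrivial.\<close>
  define j where "j = (if i = 1 then 2 else 1 :: nat)"
  have j: "j \<in> {1..n}" "j \<noteq> i" using assms(1) by (auto simp: j_def)
  let ?F = "carrier (free_group {i})" and ?G = "carrier (free_group ({1..n} - {i}))"
  have X: "{i} \<union> ({1..n} - {i}) = {1..n}" using assms by auto
  have gen: "[(i, True)] \<in> ?F" "[(j, True)] \<in> ?G" "[(j, True)] \<notin> ?F" "[(i, True)] \<notin> ?G"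
    "[(i, True)] \<in> carrier (free_group {1..n})" "[(j, True)] \<in> carrier (free_group {1..n})"
    using assms j by (auto simp: reduced_def)
  have nontriv: "nontrivial_proper_subgroup S (free_group {1..n})"
    if "subgroup S (free_group {1..n})" "[x] \<in> S" "[y] \<notin> S" "[y] \<in> carrier (free_group {1..n})"
        for S x y
    using that unfolding nontrivial_proper_subgroup_def free_group_simps(3) by blast
  have "internal_free_product (free_group {1..n}) ?F ?G"
    using free_group_disjoint_generators[of "{i}" "{1..n} - {i}"] X by simp
  moreover have "nontrivial_proper_subgroup ?F (free_group {1..n})"
    by (rule nontriv[OF subgroup_free_group_mono gen(1,3,6)]) (use assms in simp)
  moreover have "nontrivial_proper_subgroup ?G (free_group {1..n})"
    by (rule nontriv[OF subgroup_free_group_mono gen(2,4,5)]) simp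
  ultimately have "proper_free_factor ?F (free_group {1..n})" unfolding proper_free_factor_def
    by blast
  moreover have "replicate k (i, True) \<in> ?F"
    by (induction k) (auto simp: reduced_Cons inv_letter_def hd_replicate dest:
        in_set_replicate[THEN iffD1])
  ultimately show ?thesis unfolding separable_elements_def by blast
qed

section \<open>The fundamental group of a finite cover\<close>

lemma edge_path_append:
  "edge_path G u p v \<Longrightarrow> edge_path G v p' w \<Longrightarrow> edge_path G u (p @ p') w"
  by (induction G u p v rule: edge_path.induct) auto

lemma edge_path_arcs: "edge_path G u p v \<Longrightarrow> fst ` set p \<subseteq> arcs G"
  by (induction G u p v rule: edge_path.induct) auto

lemma cover_pi1_mult:
  assumes "a \<in> cover_pi1 G pE u" "b \<in> cover_pi1 G pE u"
  shows "free_reduce (a @ b) \<in> cover_pi1 G pE u"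
proof -
  obtain p p' where p: "edge_path G u p u" "a = free_reduce (map (apfst pE) p)"
    and p': "edge_path G u p' u" "b = free_reduce (map (apfst pE) p')"
    using assms unfolding cover_pi1_def by blast
  have "free_reduce (a @ b) = free_reduce (map (apfst pE) (p @ p'))" by (simp add: p(2) p'(2))
  then show ?thesis using edge_path_append[OF p(1) p'(1)] unfolding cover_pi1_def by blast
qed

lemma cover_pi1_carrier:
  assumes "covering_map G (rose n) pV pE"
  shows "cover_pi1 G pE u \<subseteq> carrier (free_group {1..n})"
proof
  fix a assume "a \<in> cover_pi1 G pE u"
  then obtain p where p: "edge_path G u p u" "a = free_reduce (map (apfst pE) p)"
    unfolding cover_pi1_def by blast
  have "fst ` set (map (apfst pE) p) = pE ` fst ` set p" by (simp add: image_image)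
  also have "\<dots> \<subseteq> pE ` arcs G" using edge_path_arcs[OF p(1)] by (rule image_mono)
  also have "\<dots> \<subseteq> {1..n}" using assms by (auto simp: covering_map_def graph_hom_def rose_def)
  finally show "a \<in> carrier (free_group {1..n})" by (simp add: p(2) fst_set_free_reduce)
qed

text \<open>Following the lifts of the loop \<open>i\<close> permutes the finitely many vertices, so
  the lift starting at \<open>u\<close> eventually closes up.\<close>

lemma cover_pi1_generator_power:
  assumes cov: "finite_regular_cover G (rose n) pV pE" and u: "u \<in> verts G" and i: "i \<in> {1..n}"
  obtains m where "m \<ge> 2" "replicate m (i, True) \<in> cover_pi1 G pE u"
proof -
  have cm: "covering_map G (rose n) pV pE" using cov unfolding finite_regular_cover_def by blast
  then interpret wf_digraph G unfolding covering_map_def by blast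
  have fin: "finite (verts G)" using cov by (simp add: finite_regular_cover_def rose_def)
  have rose_arcs: "out_arcs (rose n) x = {1..n}" "in_arcs (rose n) x = {1..n}" for x
    by (auto simp: rose_def)
  have out: "\<exists>e\<in>out_arcs G v. pE e = i" and inj: "inj_on pE (in_arcs G v)" if "v \<in> verts G" for v
    using cm that i unfolding covering_map_def rose_arcs bij_betw_def by (metis imageE)+
  define e where "e v = (SOME e. e \<in> out_arcs G v \<and> pE e = i)" for v
  have e: "e v \<in> arcs G" "tail G (e v) = v" "pE (e v) = i" if "v \<in> verts G" for v
  proof -
    have "e v \<in> out_arcs G v \<and> pE (e v) = i"
      unfolding e_def by (rule someI_ex) (use out[OF that] in blast)
    then show "e v \<in> arcs G" "tail G (e v) = v" "pE (e v) = i" by simp_all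
  qed
  \<comment> \<open>The identity outside the graph makes \<open>f\<close> injective on the whole
    type; on vertices injectivity comes from the bijection on incoming arcs.\<close>
  define f where "f v = (if v \<in> verts G then head G (e v) else v)" for v
  have fv: "f v \<in> verts G \<longleftrightarrow> v \<in> verts G" for v using e by (auto simp: f_def)
  have "inj f"
  proof (rule injI)
    fix v w assume eq: "f v = f w"
    show "v = w"
    proof (cases "v \<in> verts G")
      case True
      then have w: "w \<in> verts G" using fv eq by metis
      have "e v \<in> in_arcs G (f v)" "e w \<in> in_arcs G (f v)" using e True w eq by (auto simp: f_def)
      then have "e v = e w" using inj[of "f v"] fv True e w by (metis inj_onD)
      then show ?thesis using e True w by metis
    next
      case False
      then show ?thesis using fv[of v] fv[of w] eq by (simp add: f_def split: if_splits)
    qed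
  qed
  moreover have orbit: "(f ^^ k) u \<in> verts G" for k by (induction k) (auto simp: u fv)
  then have "finite {y. \<exists>k. y = (f ^^ k) u}" by (intro finite_subset[OF _ fin]) auto
  ultimately obtain m where m: "m > 0" "(f ^^ m) u = u" using funpow_inj_finite by metis
  have "\<exists>p. edge_path G v p ((f ^^ k) v) \<and> map (apfst pE) p = replicate k (i, True)"
      if "v \<in> verts G" for k v
    using that
  proof (induction k arbitrary: v)
    case (Suc k)
    then obtain p where "edge_path G (f v) p ((f ^^ k) (f v))"
        "map (apfst pE) p = replicate k (i, True)"
      using fv by blast
    then have "edge_path G v ((e v, True) # p) ((f ^^ Suc k) v) \<and>
        map (apfst pE) ((e v, True) # p) = replicate (Suc k) (i, True)"
      using e Suc.prems by (simp add: funpow_swap1) (simp add: f_def)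
    then show ?case by blast
  qed simp
  then obtain p where p: "edge_path G u p u" "map (apfst pE) p = replicate m (i, True)" using u m
    by metis
  \<comment> \<open>The period \<open>m\<close> may be \<open>1\<close>; running around the loop
    twice gives an exponent of at least \<open>2\<close>.\<close>
  have "reduced (replicate (m + m) (i, True))"
    by (simp add: reduced_def successively_conv_sorted_wrt inv_letter_def successively_conv_nth)
  then have "replicate (m + m) (i, True) = free_reduce (map (apfst pE) (p @ p))"
    using p(2) by (simp add: free_reduce_reduced replicate_add)
  then have "replicate (m + m) (i, True) \<in> cover_pi1 G pE u"
    using edge_path_append[OF p(1) p(1)] unfolding cover_pi1_def by blast
  then show ?thesis using that[of "m + m"] m(1) by simp
qed

section \<open>Distances in the separability complex\<close>

lemma positive_reduced: "\<forall>z\<in>set w. snd z \<Longrightarrow> reduced w"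
proof (induction w)
  case (Cons a w)
  then show ?case by (cases w) (auto simp: reduced_Cons inv_letter_def)
qed simp

text \<open>Each of the first \<open>k\<close> copies of \<open>q\<close> starts an occurrence of
  \<open>q @ q\<close>.\<close>

lemma occurrences_square_power:
  assumes "q \<noteq> []" shows "occurrences (q @ q) (word_power q (Suc k)) \<ge> k"
proof (induction k)
  case (Suc k)
  obtain x q' where q: "q = x # q'" using assms by (cases q) auto
  have "prefix (q @ q) (word_power q (Suc (Suc k)))" by simp
  then have "occurrences (q @ q) (word_power q (Suc (Suc k))) =
      1 + occurrences (q @ q) (q' @ word_power q (Suc k))"
    by (simp add: q)
  then show ?case using Suc occurrences_append_ge[of "q @ q" q' "word_power q (Suc k)"] by linarith
qed simp

text \<open>The inverse of a positive word has only negative letters, so it never occurs in a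
  positive word and nothing is subtracted.\<close>

lemma brooks_positive_power:
  assumes "q \<noteq> []" "\<forall>z\<in>set q. snd z"
  shows "brooks (q @ q) (word_power q (Suc k)) \<ge> int k"
proof -
  have "\<not> sublist (inv_word (q @ q)) (word_power q (Suc k))"
  proof
    assume "sublist (inv_word (q @ q)) (word_power q (Suc k))"
    then have "set (inv_word (q @ q)) \<subseteq> set (word_power q (Suc k))" by (rule set_mono_sublist)
    then have "set (inv_word q) \<subseteq> set q" by auto
    then show False using assms by (cases q) (auto simp: inv_letter_def)
  qed
  then show ?thesis using occurrences_square_power[OF assms(1), of k]
    by (simp add: brooks_def occurrences_eq_0)
qed

lemma conj_class_free_group:
  assumes "g \<in> carrier (free_group X)" "w \<in> conj_class (free_group X) g"
  obtains h where "reduced h" "w = free_reduce (h @ g @ inv_word h)"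
proof -
  obtain h where h: "h \<in> carrier (free_group X)"
      "w = h \<otimes>\<^bsub>free_group X\<^esub> g \<otimes>\<^bsub>free_group X\<^esub> inv\<^bsub>free_group X\<^esub> h"
    using assms unfolding conj_class_def by blast
  then show ?thesis using that[of h] inv_free_group[OF h(1)] by simp
qed

lemma self_in_conj_class:
  assumes "g \<in> carrier (free_group X)" shows "g \<in> conj_class (free_group X) g"
proof -
  interpret group "free_group X" by (rule group_free_group)
  have "g = \<one>\<^bsub>free_group X\<^esub> \<otimes>\<^bsub>free_group X\<^esub> g \<otimes>\<^bsub>free_group X\<^esub> inv\<^bsub>free_group X\<^esub> \<one>\<^bsub>free_group X\<^esub>"
    using assms by (simp del: free_group_simps)
  then show ?thesis unfolding conj_class_def using one_closed by blast
qed

lemma brooks_conj_class: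
  assumes "p \<noteq> []" "g \<in> carrier (free_group X)" "w \<in> conj_class (free_group X) g"
  shows "reduced w" "\<bar>brooks p w - brooks p g\<bar> \<le> 6 * int (length p)"
proof -
  obtain h where h: "reduced h" "w = free_reduce (h @ g @ inv_word h)"
    using conj_class_free_group[OF assms(2,3)] .
  then show "reduced w" "\<bar>brooks p w - brooks p g\<bar> \<le> 6 * int (length p)"
    using brooks_conjugate[OF assms(1) h(1), of g] assms(2) by simp_all
qed

text \<open>In units of \<open>length p\<close>, the product costs \<open>3\<close>, the separable
  representative \<open>2\<close>, and each of the five changes of representative within a class
  \<open>6\<close>.\<close>

lemma brooks_separability_arc:
  assumes n: "n \<ge> 1" and p: "hamiltonian n p" and H: "H \<subseteq> carrier (free_group {1..n})"
    and arc: "(V, A, W) \<in> arcs (separability_complex (free_group {1..n}) H)"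
    and vw: "v \<in> V" "w \<in> W"
  shows "\<bar>brooks p w - brooks p v\<bar> \<le> 35 * int (length p)"
proof -
  let ?K = "free_group {1..n}"
  have "p \<noteq> []" using p by (auto simp: hamiltonian_def)
  obtain g g' a0 where g: "g \<in> H" "V = conj_class ?K g" "g' \<in> H" "W = conj_class ?K g'"
    and a0: "a0 \<in> separable_elements ?K" "a0 \<in> H" "A = conj_class ?K a0"
    using arc by (auto simp: separability_complex_def)
  obtain v' a w' where v': "v' \<in> V" "a \<in> A" "w' \<in> W" "w' = free_reduce (v' @ a)"
    using arc by (auto simp: separability_complex_def)
  have car: "g \<in> carrier ?K" "g' \<in> carrier ?K" "a0 \<in> carrier ?K" using g a0 H by blast+
  note bv = brooks_conj_class[OF \<open>p \<noteq> []\<close> car(1)] and bw = brooks_conj_class[OF \<open>p \<noteq> []\<close> car(2)]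
    and ba = brooks_conj_class[OF \<open>p \<noteq> []\<close> car(3)]
  have "\<bar>brooks p w' - brooks p v' - brooks p a\<bar> \<le> 3 * int (length p)"
    unfolding v'(4) using brooks_quasimorphism[OF \<open>p \<noteq> []\<close>] bv(1) ba(1) v' g a0 by simp
  moreover have "\<bar>brooks p a - brooks p a0\<bar> \<le> 6 * int (length p)" using ba(2) v'(2) a0(3) by simp
  moreover have "\<bar>brooks p a0\<bar> \<le> 2 * int (length p)" by (rule brooks_separable[OF n p a0(1)])
  moreover have "\<bar>brooks p v - brooks p g\<bar> \<le> 6 * int (length p)"
      "\<bar>brooks p v' - brooks p g\<bar> \<le> 6 * int (length p)"
    using bv(2) vw v' g by simp_all
  moreover have "\<bar>brooks p w - brooks p g'\<bar> \<le> 6 * int (length p)"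
      "\<bar>brooks p w' - brooks p g'\<bar> \<le> 6 * int (length p)"
    using bw(2) vw v' g by simp_all
  ultimately show ?thesis by linarith
qed

text \<open>Adding the arc and its head to \<open>C\<close> keeps it connected, so by maximality
  they were already there.\<close>

lemma connected_component_closed:
  assumes comp: "connected_component_of_graph G C" and e: "e \<in> arcs G" "tail G e \<in> verts C"
  shows "head G e \<in> verts C"
proof -
  have sub: "subgraph C G" and conn: "Digraph_Component.connected C"
    and max: "\<And>D. D \<noteq> C \<Longrightarrow> subgraph C D \<Longrightarrow> subgraph D G \<Longrightarrow> \<not> Digraph_Component.connected D"
    using comp by (auto simp: connected_component_of_graph_def pre_digraph.max_subgraph_def)
  have wf: "wf_digraph G" "wf_digraph C" and compat: "tail G = tail C" "head G = head C"
    and incl: "verts C \<subseteq> verts G" "arcs C \<subseteq> arcs G"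
    using sub by (auto simp: subgraph_def compatible_def)
  define D where "D = C\<lparr>verts := insert (head G e) (verts C), arcs := insert e (arcs C)\<rparr>"
  have D: "verts D = insert (head G e) (verts C)" "arcs D = insert e (arcs C)" "tail D = tail G"
      "head D = head G"
    by (simp_all add: D_def compat)
  have wfD: "wf_digraph D"
    using wf(2) e compat by (auto simp: wf_digraph_def D)
  have "subgraph C D" using wf wfD by (auto simp: subgraph_def D compatible_def compat)
  moreover have "subgraph D G"
    using wf wfD incl e wf_digraph.head_in_verts[OF wf(1)]
    by (auto simp: subgraph_def D compatible_def)
  moreover have "Digraph_Component.connected D"
  proof -
    interpret S: pair_wf_digraph "mk_symmetric D" using wf_digraph.wellformed_mk_symmetric[OF wfD] .
    have sym: "symmetric (with_proj (mk_symmetric D))" by (rule symmetric_mk_symmetric)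
    have subS: "subgraph (with_proj (mk_symmetric C)) (with_proj (mk_symmetric D))"
      by (rule subgraph_mk_symmetric[OF \<open>subgraph C D\<close>])
    have to: "u \<rightarrow>\<^sup>*\<^bsub>with_proj (mk_symmetric D)\<^esub> tail G e" if u: "u \<in> verts D" for u
    proof (cases "u \<in> verts C")
      case True
      then have "u \<rightarrow>\<^sup>*\<^bsub>with_proj (mk_symmetric C)\<^esub> tail G e"
        using conn e(2) by (auto simp: Digraph_Component.connected_def strongly_connected_def)
      then show ?thesis using subS by (rule S.reachable_mono)
    next
      case False
      then have "(u, tail G e) \<in> parcs (mk_symmetric D)" using u
        by (auto simp: parcs_mk_symmetric D)
      then show ?thesis by (intro S.reachable_adjI) simp
    qed
    have "u \<rightarrow>\<^sup>*\<^bsub>with_proj (mk_symmetric D)\<^esub> v" if "u \<in> verts D" "v \<in> verts D" for u v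
      using S.reachable_trans[OF to[OF that(1)] symmetric_reachable[OF sym to[OF that(2)]]] .
    then show ?thesis by (auto simp: Digraph_Component.connected_def strongly_connected_def D)
  qed
  ultimately have "D = C" using max by blast
  then show ?thesis using D(1) by auto
qed

text \<open>Arcs may be crossed backwards, but the bound for one arc is symmetric. The additive term
  is for the empty walk, where \<open>v\<close> and \<open>w\<close> can be different elements of
  one class.\<close>

lemma brooks_walk:
  assumes n: "n \<ge> 1" and p: "hamiltonian n p" and H: "H \<subseteq> carrier (free_group {1..n})"
    and sub: "subgraph C (separability_complex (free_group {1..n}) H)"
    and walk: "pre_digraph.awalk (with_proj (mk_symmetric C)) V es W"
    and vw: "v \<in> V" "w \<in> W"
  shows "\<bar>brooks p w - brooks p v\<bar> \<le> 35 * int (length p) * int (length es) + 12 * int (length p)"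
proof -
  let ?K = "free_group {1..n}"
  have C: "verts C \<subseteq> conj_class ?K ` H" "arcs C \<subseteq> arcs (separability_complex ?K H)"
    "tail C = (\<lambda>(V, A, W). V)" "head C = (\<lambda>(V, A, W). W)" "wf_digraph C"
    using sub by (auto simp: subgraph_def compatible_def separability_complex_def)
  have "p \<noteq> []" using p by (auto simp: hamiltonian_def)
  have ne: "\<exists>v. v \<in> V" if "V \<in> verts C" for V using that C(1) H self_in_conj_class by blast
  interpret S: pair_wf_digraph "mk_symmetric C" using wf_digraph.wellformed_mk_symmetric[OF C(5)] .
  show ?thesis using walk vw(1)
  proof (induction es arbitrary: V v)
    case Nil
    then have VW: "V = W" "W \<in> verts C" by (auto simp: S.awalk_Nil_iff)
    then obtain g where g: "g \<in> carrier ?K" "W = conj_class ?K g" using C(1) H by blast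
    show ?case
      using brooks_conj_class(2)[OF \<open>p \<noteq> []\<close> g(1), of v] brooks_conj_class(2)[OF \<open>p \<noteq>
          []\<close> g(1), of w]
        vw(2) Nil.prems(2) VW(1) g(2) by simp
  next
    case (Cons e es)
    obtain V' U where e: "e = (V', U)" by (cases e)
    have ee: "(V, U) \<in> parcs (mk_symmetric C)" "S.awalk U es W"
      using Cons.prems(1) by (auto simp: S.awalk_Cons_iff e)
    have "U \<in> verts C" using S.awalk_hd_in_verts[OF ee(2)] by simp
    then obtain x where x: "x \<in> U" using ne by blast
    obtain A where "(V, A, U) \<in> arcs C \<or> (U, A, V) \<in> arcs C"
      using ee(1) by (auto simp: parcs_mk_symmetric C(3,4))
    then have "\<bar>brooks p x - brooks p v\<bar> \<le> 35 * int (length p)"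
      using brooks_separability_arc[OF n p H, of V A U v x] brooks_separability_arc[OF n p H, of U
          A V x v]
        x Cons.prems(2) C(2) by auto
    moreover have "\<bar>brooks p w - brooks p x\<bar> \<le> 35 * int (length p) * int (length es) + 12 * int
        (length p)"
      by (rule Cons.IH[OF ee(2) x])
    ultimately show ?case by (simp add: algebra_simps)
  qed
qed

theorem theorem1p3:
  fixes n :: nat
    and \<Gamma> :: "('v, 'e) pre_digraph"
    and pV :: "'v \<Rightarrow> unit" and pE :: "'e \<Rightarrow> nat"
    and u :: 'v
    and C :: "(nat word set, nat word set \<times> nat word set \<times> nat word set) pre_digraph"
  assumes "n \<ge> 2"
    and "finite_regular_cover \<Gamma> (rose n) pV pE"
    and "u \<in> verts \<Gamma>"
    and "connected_component_of_graph (SC n \<Gamma> pE u) C"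
  shows "graph_diameter C = \<infinity>"
proof -
  let ?K = "free_group {1..n}"
  define H where "H = cover_pi1 \<Gamma> pE u"
  let ?G = "separability_complex ?K H"
  have comp: "connected_component_of_graph ?G C" using assms(4) by (simp add: SC_def H_def)
  have sub: "subgraph C ?G" and conn: "Digraph_Component.connected C"
    using comp by (auto simp: connected_component_of_graph_def pre_digraph.max_subgraph_def)
  have H: "H \<subseteq> carrier ?K"
    unfolding H_def using assms(2) unfolding finite_regular_cover_def
    by (rule cover_pi1_carrier[OF conjunct1])
  have "\<forall>i\<in>{1..n}. \<exists>m\<ge>2. replicate m (i, True) \<in> H"
    unfolding H_def using cover_pi1_generator_power[OF assms(2,3)] by metis
  from bchoice[OF this] obtain m where m: "\<And>i. i \<in> {1..n} \<Longrightarrow> m i \<ge> 2 \<and> replicate (m i) (i, True) \<in> H"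
    by blast
  define block where "block i = replicate (m i) (i, True)" for i
  \<comment> \<open>\<open>q\<close> is a product of powers of all generators in order. Doubling it
    to \<open>p\<close> adds the pair from \<open>n\<close> back to \<open>1\<close> and makes
    \<open>p\<close> occur often in the powers of \<open>q\<close>.\<close>
  define q where "q = concat (map block [1..<Suc n])"
  define p where "p = q @ q"
  have block: "sublist [(i, True), (i, True)] (block i)" "\<exists>r. block i = (i, True) # r"
      "\<exists>r. block i = r @ [(i, True)]"
    if i: "i \<in> {1..n}" for i
  proof -
    obtain k where "m i = 2 + k" using m[OF i] le_Suc_ex by blast
    then have "m i = Suc (Suc k)" by simp
    then have *: "block i = (i, True) # (i, True) # replicate k (i, True)" by (simp add: block_def)
    show "sublist [(i, True), (i, True)] (block i)" unfolding *
      by (simp add: sublist_def) (metis append_Nil)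
    show "\<exists>r. block i = (i, True) # r" using * by blast
    show "\<exists>r. block i = r @ [(i, True)]" using \<open>m i = Suc (Suc k)\<close>
      unfolding block_def by (metis replicate_Suc replicate_append_same)
  qed
  have ham: "hamiltonian n p"
    unfolding hamiltonian_def
  proof (intro conjI ballI)
    fix i assume i: "i \<in> {1..n}"
    have "[1..<Suc n] = [1..<i] @ i # [Suc i..<Suc n]" 
      using i upt_add_eq_append[of 1 i "Suc n - i"] by (simp add: upt_conv_Cons del: upt_Suc)
    then have "sublist (block i) p" by (simp add: p_def q_def sublist_def) (metis append_assoc)
    then show "sublist [(i, True), (i, True)] p" using block(1)[OF i] sublist_order.order_trans
      by blast
  next
    fix i assume i: "i \<in> {1..<n}"
    have "[1..<Suc n] = [1..<i] @ i # Suc i # [Suc (Suc i)..<Suc n]"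
      using i upt_add_eq_append[of 1 i "Suc n - i"] by (simp add: upt_conv_Cons del: upt_Suc)
    then have "sublist (block i @ block (Suc i)) p"
      by (simp add: p_def q_def sublist_def) (metis append_assoc)
    moreover obtain r r' where "block i = r @ [(i, True)]" "block (Suc i) = (Suc i, True) # r'"
      using block(3)[of i] block(2)[of "Suc i"] i by auto
    then have "block i @ block (Suc i) = r @ [(i, True), (Suc i, True)] @ r'" by simp
    then have "sublist [(i, True), (Suc i, True)] (block i @ block (Suc i))" unfolding sublist_def
      by blast
    ultimately show "sublist [(i, True), (Suc i, True)] p" using sublist_order.order_trans by blast
  next
    \<comment> \<open>The pair sits where the two copies of \<open>q\<close> meet.\<close>
    obtain r where r: "block n = r @ [(n, True)]" using block(3)[of n] assms(1) by auto
    obtain r' where r': "block 1 = (1, True) # r'" using block(2)[of 1] assms(1) by auto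
    have "q = concat (map block [1..<n]) @ r @ [(n, True)]" using assms(1) r by (simp add: q_def)
    moreover have "q = (1, True) # r' @ concat (map block [Suc 1..<Suc n])"
      using assms(1) r' upt_conv_Cons[of 1 "Suc n"] by (simp add: q_def del: upt_Suc)
    ultimately have "p = (concat (map block [1..<n]) @ r) @ [(n, True), (1, True)] @ r' @ concat
        (map block [Suc 1..<Suc n])"
      unfolding p_def by (metis append.assoc append_Cons append_Nil)
    then show "sublist [(n, True), (1, True)] p" unfolding sublist_def by blast
  qed
  have "q \<noteq> []" using ham by (auto simp: hamiltonian_def p_def)
  have pos: "\<forall>z\<in>set q. snd z" by (auto simp: q_def block_def)
  have "verts C \<noteq> {}" using conn by (auto simp: Digraph_Component.connected_def
      strongly_connected_def)
  then obtain v where v: "v \<in> H" "conj_class ?K v \<in> verts C"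
    using sub by (auto simp: subgraph_def separability_complex_def)
  \<comment> \<open>Multiplying by one block after another follows arcs of the complex, since each
    block is a nontrivial separable element of \<open>H\<close>.\<close>
  have reach: "free_reduce (v @ concat (map block is)) \<in> H \<and>
      conj_class ?K (free_reduce (v @ concat (map block is)))
          \<in> verts C" if "set is \<subseteq> {1..n}" for "is"
    using that
  proof (induction "is" rule: rev_induct)
    case Nil
    then show ?case using v H by (auto simp: free_reduce_reduced subset_iff)
  next
    case (snoc i "is")
    let ?w = "free_reduce (v @ concat (map block is))"
        and ?w' = "free_reduce (v @ concat (map block (is @ [i])))"
    have i: "i \<in> {1..n}" and IH: "?w \<in> H" "conj_class ?K ?w \<in> verts C" using snoc by auto
    have bi: "block i \<in> H" "block i \<noteq> []" "block i \<in> separable_elements ?K"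
      using m[OF i] generator_power_separable[OF assms(1) i] by (auto simp: block_def)
    have w': "?w' = free_reduce (?w @ block i)" by simp
    then have w'H: "?w' \<in> H" using IH(1) bi(1) cover_pi1_mult unfolding H_def by metis
    have "?w' = ?w \<otimes>\<^bsub>?K\<^esub> block i" using w' by simp
    moreover have "?w \<in> conj_class ?K ?w" "?w' \<in> conj_class ?K ?w'"
        "block i \<in> conj_class ?K (block i)"
      using IH(1) w'H bi(1) H by (auto intro!: self_in_conj_class simp del: free_group_simps)
    ultimately have "(conj_class ?K ?w, conj_class ?K (block i), conj_class ?K ?w') \<in> arcs ?G"
      unfolding separability_complex_def using IH(1) w'H bi
      by (simp del: free_group_simps(1,2)) blast
    then have "conj_class ?K ?w' \<in> verts C"
      using connected_component_closed[OF comp, of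
          "(conj_class ?K ?w, conj_class ?K (block i), conj_class ?K ?w')"] IH(2)
      by (simp add: separability_complex_def)
    with w'H show ?case by simp
  qed
  have wfC: "wf_digraph C" using sub by (simp add: subgraph_def)
  interpret S: pair_wf_digraph "mk_symmetric C" using wf_digraph.wellformed_mk_symmetric[OF wfC] .
  have cost: "S.awalk_cost (\<lambda>_. 1) es = real (length es)" for es
    by (induction es) auto
  show ?thesis
  proof (rule ereal_top)
    fix B :: real
    define L where "L = int (length p)"
    obtain N :: nat where N: "B \<le> real N" using real_arch_simple by blast
    \<comment> \<open>Chosen so that \<open>k - 3 * L\<close> is at least
      \<open>35 * L * N + 12 * L\<close>: the \<open>15\<close> pays \<open>3\<close> for the
      product with \<open>v\<close> and \<open>12\<close> for the additive term of a walk.\<close>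
    define k where "k = nat (35 * L * int N + 15 * L)"
    define w where "w = free_reduce (v @ word_power q (Suc k))"
    have "word_power q j = concat (map block (word_power [1..<Suc n] j))" for j
      by (induction j) (simp_all add: q_def)
    moreover have "set (word_power [1..<Suc n] (Suc k)) \<subseteq> {1..n}" by auto
    ultimately have w: "w \<in> H" "conj_class ?K w \<in> verts C"
      using reach[of "word_power [1..<Suc n] (Suc k)"] by (simp_all add: w_def del: replicate.simps)
    have "p \<noteq> []" using \<open>q \<noteq> []\<close> by (simp add: p_def)
    moreover have "reduced v" using subsetD[OF H v(1)] by simp
    moreover have "reduced (word_power q (Suc k))" using pos by (intro positive_reduced) auto
    ultimately have far: "brooks p w - brooks p v \<ge> int k - 3 * L"
      using brooks_quasimorphism[of p v "word_power q (Suc k)"] brooks_positive_power[OF \<open>q \<noteq>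
          []\<close> pos, of k]
      unfolding w_def L_def p_def[symmetric] by linarith
    \<comment> \<open>Each step changes the value by at most \<open>35 * L\<close> up to the
      additive term, so covering the gap takes at least \<open>N\<close> steps.\<close>
    have len: "real N \<le> real (length es)" if es: "S.awalk (conj_class ?K v) es (conj_class ?K w)"
        for es
    proof -
      have "brooks p w - brooks p v \<le> 35 * L * int (length es) + 12 * L"
        using brooks_walk[OF _ ham H sub es self_in_conj_class self_in_conj_class] subsetD[OF H
            v(1)]
          subsetD[OF H w(1)] assms(1) by (simp add: L_def)
      then have "35 * L * int N \<le> 35 * L * int (length es)" using far by (simp add: k_def L_def)
      moreover have "L > 0" using \<open>p \<noteq> []\<close> by (simp add: L_def)
      ultimately show ?thesis by simp
    qed
    have "ereal B \<le> ereal (real N)" using N by simp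
    also have "\<dots> \<le> path_dist C (conj_class ?K v) (conj_class ?K w)"
      unfolding path_dist_def S.\<mu>_def by (intro INF_greatest) (use len cost in auto)
    also have "\<dots> \<le> graph_diameter C"
      unfolding graph_diameter_def using v(2) w(2)
      by (intro SUP_upper2[of "(conj_class ?K v, conj_class ?K w)"]) auto
    finally show "ereal B \<le> graph_diameter C" .
  qed
qed

end
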